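(* Let $n>1$ and let $\mathscr{L}=\mathscr{L}(s,\mathbf{u},\mathbf{p},\mathbf{q})$ be a smooth second-order Lagrangian. If $\mathscr{L}$ is a $\mathcal{T}$-Lagrangian, then $\mathscr{L}$ has the local representation $$\mathscr{L}(s,\mathbf{u}(s),\mathbf{u}'(s),\mathbf{u}''(s))=D_s\,\Xi\big(s,\mathbf{u}(s),r(s),\boldsymbol{\theta}(s)\big)+r(s)\,f\Big(\mathbf{u}(s),\boldsymbol{\theta}(s),\frac{\boldsymbol{\eta}(s)}{r(s)}\Big)$$ for some smooth functions $\Xi$ and $f$, where $(r,\boldsymbol{\theta},\xi,\boldsymbol{\eta})$ are the local coordinates associated with $(\mathbf{p},\mathbf{q})=(\mathbf{u}',\mathbf{u}'')$. Explicitly: for every point $(s_0,\mathbf{u}_0,r_0,\boldsymbol{\theta}_0,\xi_0,\boldsymbol{\eta}_0)$ with $s_0\in[0,1]$, $r_0>0$ and $\hat{\mathbf{p}}_{,\boldsymbol{\theta}}(\boldsymbol{\theta}_0)$ of rank $n-1$, there exist smooth real-valued functions $\Xi(s,\mathbf{u},r,\boldsymbol{\theta})$, defined near $(s_0,\mathbf{u}_0,r_0,\boldsymbol{\theta}_0)$, and $f(\mathbf{u},\boldsymbol{\theta},\boldsymbol{\zeta})$, defined near $(\mathbf{u}_0,\boldsymbol{\theta}_0,\boldsymbol{\eta}_0/r_0)$, such that for all $(s,\mathbf{u},r,\boldsymbol{\theta},\xi,\boldsymbol{\eta})$ near the given point, with $\mathbf{p}=r\hat{\mathbf{p}}(\boldsymbol{\theta})$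 and $\mathbf{q}=r\xi\hat{\mathbf{p}}(\boldsymbol{\theta})+r\hat{\mathbf{p}}_{,\boldsymbol{\theta}}(\boldsymbol{\theta})[\boldsymbol{\eta}]$, $$\mathscr{L}(s,\mathbf{u},\mathbf{p},\mathbf{q})=\Xi_{,s}+\mathbf{p}\cdot\Xi_{,\mathbf{u}}+r\xi\,\Xi_{,r}+\boldsymbol{\eta}\cdot\Xi_{,\boldsymbol{\theta}}+r\,f\Big(\mathbf{u},\boldsymbol{\theta},\frac{\boldsymbol{\eta}}{r}\Big).$$
   Context: A second-order Lagrangian is a smooth function $\mathscr{L}(s,\mathbf{u},\mathbf{p},\mathbf{q})$ of $s\in[0,1]$, $\mathbf{u}\in\mathbb{R}^n$, $\mathbf{p}\in\mathbb{R}^n\setminus\{\mathbf{0}\}$, $\mathbf{q}\in\mathbb{R}^n$; its functional is $\mathcal{E}(\mathbf{u})=\int_0^1\mathscr{L}(s,\mathbf{u},\mathbf{u}',\mathbf{u}'')\,ds$. Let $\mathcal{C}^4_R$ be the set of $\mathbf{u}\in C^4([0,1];\mathbb{R}^n)$ with $\mathbf{u}'(s)\ne\mathbf{0}$ for all $s$, and $\mathcal{C}^\infty_c$ the smooth functions $[0,1]\to\mathbb{R}^n$ with compact support in $(0,1)$. The first variation is $\delta\mathcal{E}[\delta\mathbf{u}]=\int_0^1(\mathscr{L}_{\mathbf{u}}\cdot\delta\mathbf{u}+\mathscr{L}_{\mathbf{u}'}\cdot\delta\mathbf{u}'+\mathscr{L}_{\mathbf{u}''}\cdot\delta\mathbf{u}'')\,ds$,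 where $\mathscr{L}_{\mathbf{u}},\mathscr{L}_{\mathbf{u}'},\mathscr{L}_{\mathbf{u}''}$ are the gradients in $\mathbf{u},\mathbf{p},\mathbf{q}$ evaluated along $(s,\mathbf{u}(s),\mathbf{u}'(s),\mathbf{u}''(s))$. For $\mathbf{u}\in\mathcal{C}^4_R$ let $T_{\mathbf{u}}=\{\mathbf{v}\in\mathcal{C}^\infty_c:\mathbf{v}=\psi\mathbf{u}'\text{ for some }\psi\in C^\infty_c((0,1);\mathbb{R})\}$. $\mathscr{L}$ is a $\mathcal{T}$-Lagrangian if for every $\mathbf{u}\in\mathcal{C}^4_R$, $\delta\mathcal{E}[\delta\mathbf{u}]=0$ for all $\delta\mathbf{u}\in T_{\mathbf{u}}$. Coordinates: for $\boldsymbol{\theta}=(\theta_1,\dots,\theta_{n-1})$, $\hat{\mathbf{p}}(\boldsymbol{\theta})\in\mathcal{S}^{n-1}$ is given by $\hat p_1=\cos\theta_1$, $\hat p_k=\sin\theta_1\cdots\sin\theta_{k-1}\cos\theta_k$ ($2\le k\le n-1$), $\hat p_n=\sin\theta_1\cdots\sin\theta_{n-1}$; $\hat{\mathbf{p}}_{,\boldsymbol{\theta}}$ is its $n\times(n-1)$ Jacobian matrix. The local change of variables $(\mathbf{p},\mathbf{q})\mapsto(r,\boldsymbol{\theta},\xi,\boldsymbol{\eta})$, $\boldsymbol\eta\in\mathbb{R}^{n-1}$, is $r=\|\mathbf{p}\|$, $\hat{\mathbf{p}}(\boldsymbol{\theta})=\mathbf{p}/r$, $\xi=\mathbf{p}\cdot\mathbf{q}/r^2$,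 $r\hat{\mathbf{p}}_{,\boldsymbol{\theta}}[\boldsymbol{\eta}]=\mathbf{q}-(\mathbf{q}\cdot\hat{\mathbf{p}})\hat{\mathbf{p}}$, with inverse $\mathbf{p}=r\hat{\mathbf{p}}$, $\mathbf{q}=r\xi\hat{\mathbf{p}}+r\hat{\mathbf{p}}_{,\boldsymbol{\theta}}[\boldsymbol{\eta}]$. Along a curve with $\mathbf{p}=\mathbf{u}'$, $\mathbf{q}=\mathbf{u}''$ one has $r'=r\xi$, $\boldsymbol{\theta}'=\boldsymbol{\eta}$. $D_s$ is the total derivative in $s$; subscripts after a comma are partial derivatives (gradients); "near" means in a neighbourhood (relative to $[0,1]$ in $s$). *)

theory Defs
  imports "HOL-Analysis.Analysis"
begin

text \<open>
  \<open>Ck_on k S f\<close> is used for sets \<open>S\<close> that are open, or relatively open in a product of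
  \<open>[0,1]\<close> with a Euclidean space. On such sets the derivative within \<open>S\<close> is unique; at the
  endpoints of \<open>[0,1]\<close> it is one-sided in that variable. The domain is finite-dimensional,
  so continuity of all iterated directional derivatives is continuity of the iterated
  Frechet derivatives.
\<close>

primrec Ck_on :: "nat \<Rightarrow> 'a::euclidean_space set \<Rightarrow> ('a \<Rightarrow> 'b::real_normed_vector) \<Rightarrow> bool" where
  "Ck_on 0 S f \<longleftrightarrow> continuous_on S f"
| "Ck_on (Suc k) S f \<longleftrightarrow>
     (\<exists>f'. (\<forall>x\<in>S. (f has_derivative f' x) (at x within S)) \<and> (\<forall>v. Ck_on k S (\<lambda>x. f' x v)))"

definition smooth_on :: "'a::euclidean_space set \<Rightarrow> ('a \<Rightarrow> 'b::real_normed_vector) \<Rightarrow> bool" where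
  "smooth_on S f \<longleftrightarrow> (\<forall>k. Ck_on k S f)"

definition gradient :: "('a::real_inner \<Rightarrow> real) \<Rightarrow> 'a \<Rightarrow> 'a" where
  "gradient f x = (THE D. GDERIV f x :> D)"

text \<open>Curves are total functions on \<open>real\<close>, of which only the values on \<open>[0,1]\<close> matter.\<close>

definition curve_deriv :: "(real \<Rightarrow> 'a::real_normed_vector) \<Rightarrow> real \<Rightarrow> 'a" where
  "curve_deriv u s = vector_derivative u (at s within {0..1})"

definition C4_regular :: "(real \<Rightarrow> real^'n) set" where
  "C4_regular = {u. Ck_on 4 {0..1} u \<and> (\<forall>s\<in>{0..1}. curve_deriv u s \<noteq> 0)}"

text \<open>
  The closure is the support. It is bounded and closed, hence compact. Functions in
  \<open>C\<^sub>c\<^sup>\<infinity>((0,1))\<close> are identified with their extension by zero to \<open>[0,1]\<close>.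
\<close>

definition Cc_infinity :: "(real \<Rightarrow> 'a::real_normed_vector) set" where
  "Cc_infinity = {v. smooth_on {0..1} v \<and> closure {s\<in>{0..1}. v s \<noteq> 0} \<subseteq> {0<..<1}}"

definition smooth_lagrangian ::
  "(real \<Rightarrow> real^'n \<Rightarrow> real^'n \<Rightarrow> real^'n \<Rightarrow> real) \<Rightarrow> bool" where
  "smooth_lagrangian L \<longleftrightarrow>
     smooth_on ({0..1} \<times> UNIV \<times> (- {0}) \<times> UNIV) (\<lambda>(s, u, p, q). L s u p q)"

definition first_variation ::
  "(real \<Rightarrow> real^'n \<Rightarrow> real^'n \<Rightarrow> real^'n \<Rightarrow> real) \<Rightarrow>
    (real \<Rightarrow> real^'n) \<Rightarrow> (real \<Rightarrow> real^'n) \<Rightarrow> real" where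
  "first_variation L u v =
     integral {0..1} (\<lambda>s.
       let p = curve_deriv u s; q = curve_deriv (curve_deriv u) s
       in gradient (\<lambda>x. L s x p q) (u s) \<bullet> v s
        + gradient (\<lambda>x. L s (u s) x q) p \<bullet> curve_deriv v s
        + gradient (\<lambda>x. L s (u s) p x) q \<bullet> curve_deriv (curve_deriv v) s)"

definition tangential_variations :: "(real \<Rightarrow> real^'n) \<Rightarrow> (real \<Rightarrow> real^'n) set" where
  "tangential_variations u =
     {v \<in> Cc_infinity. \<exists>\<psi>\<in>Cc_infinity. \<forall>s\<in>{0..1}. v s = \<psi> s *\<^sub>R curve_deriv u s}"

definition T_lagrangian ::
  "(real \<Rightarrow> real^'n \<Rightarrow> real^'n \<Rightarrow> real^'n \<Rightarrow> real) \<Rightarrow> bool" where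
  "T_lagrangian L \<longleftrightarrow>
     (\<forall>u\<in>C4_regular. \<forall>v\<in>tangential_variations u. first_variation L u v = 0)"

text \<open>The position of \<open>i\<close> in the ordered index type, counted from \<open>0\<close>.\<close>

definition idx :: "'a::{finite,linorder} \<Rightarrow> nat" where
  "idx i = card {j. j < i}"

text \<open>
  Spherical coordinates, for \<open>CARD('n) = CARD('m) + 1\<close>. The cosine product has the single
  factor with the same position as \<open>k\<close>, and is empty when \<open>k\<close> is the last index of \<open>'n\<close>.
\<close>

definition phat :: "real^'m::{finite,linorder} \<Rightarrow> real^'n::{finite,linorder}" where
  "phat \<theta> = (\<chi> k. (\<Prod>j | idx j < idx k. sin (\<theta> $ j)) * (\<Prod>j | idx j = idx k. cos (\<theta> $ j)))"

definition phat_jac :: "real^'m::{finite,linorder} \<Rightarrow> real^'m::_^'n::{finite,linorder}" where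
  "phat_jac \<theta> = jacobian phat (at \<theta>)"

end

theory Submission
  imports Defs
begin

text \<open>
  Inserting the variation \<open>\<psi> u'\<close> gives
  \<open>\<integral> (\<psi>'' B + \<psi>' A - \<psi> L\<^sub>s) ds = 0\<close> with \<open>B = L\<^sub>q \<cdot> p\<close> and
  \<open>A = L\<^sub>p \<cdot> p + 2 L\<^sub>q \<cdot> q - L\<close>, hence \<open>B'' = A' + L\<^sub>s\<close> along every regular curve.
  The jet of a curve at a point is free, so comparing the coefficients of the fourth and third derivatives
  shows that neither \<open>B\<close> nor \<open>C = B' - A\<close> depends on \<open>q\<close>, and \<open>C' = L\<^sub>s\<close> remains.
  In the coordinates \<open>(r, \<theta>, \<xi>, \<eta>)\<close> the first fact says that \<open>L\<close> is affine in \<open>\<xi>\<close> with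
  slope \<open>B\<close>, and \<open>C' = L\<^sub>s\<close> makes \<open>C ds + (B / r) dr\<close> closed. Its primitive \<open>\<Xi>\<close> satisfies
  \<open>\<Xi>\<^sub>s = C\<close> and \<open>\<Xi>\<^sub>r = B / r\<close>, and what remains of \<open>L\<close> after subtracting its total derivative
  is independent of \<open>s\<close> and \<open>\<xi>\<close> and homogeneous of degree one in \<open>(r, \<eta>)\<close>.
\<close>

section \<open>Smooth functions\<close>

text \<open>Three obstacles shape the proof. The parameter s runs over a closed interval, so
  derivatives are taken within a set; \<open>coord_dense\<close> makes them unique there. Test
  curves must be regular on all of [0,1], not just near s0, so third and fourth derivatives at s0
  are free only in a small ball; this suffices because each enters the equation it is tested in
  affinely. Finally, differentiating the remainder of L in s and r would bring in mixed derivatives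
  of Xi. Instead, (L - C) / r is followed along the very segment from (s0, r0) to (s, r) that
  defines Xi: its increment is a derivative of Xi, and f is its value at the starting point. The
  term -L in A arises from L_u.u' + L_p.u'' + L_q.u''' = D_s L - L_s, since psi D_s L integrates to
  the same value as -psi' L. The closed form arises by using C' = L_s at q and at q + p: the
  difference is C_p.p on the left and, as L is affine along p with slope B, B_s on the
  right.\<close>

lemma has_derivative_chain:
  assumes "(g has_derivative g') (at (f x) within T)" "(f has_derivative f') (at x within S)"
    and "f ` S \<subseteq> T"
  shows "((\<lambda>x. g (f x)) has_derivative (\<lambda>v. g' (f' v))) (at x within S)"
  using has_derivative_in_compose[OF assms(2) has_derivative_subset[OF assms(1,3)]] .

lemma Ck_on_SucI:
  assumes "\<And>x. x \<in> S \<Longrightarrow> (f has_derivative f' x) (at x within S)"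
    and "\<And>v. Ck_on k S (\<lambda>x. f' x v)"
  shows "Ck_on (Suc k) S f"
  using assms by auto

lemma Ck_on_SucE:
  assumes "Ck_on (Suc k) S f"
  obtains f' where "\<And>x. x \<in> S \<Longrightarrow> (f has_derivative f' x) (at x within S)"
    and "\<And>v. Ck_on k S (\<lambda>x. f' x v)"
  using assms by auto

lemma Ck_on_continuous_on:
  assumes "Ck_on k S f"
  shows "continuous_on S f"
proof (cases k)
  case 0
  then show ?thesis using assms by simp
next
  case (Suc j)
  with assms obtain f' where "\<And>x. x \<in> S \<Longrightarrow> (f has_derivative f' x) (at x within S)"
    by (auto elim: Ck_on_SucE)
  then show ?thesis by (rule has_derivative_continuous_on)
qed

lemma Ck_on_Suc_imp: "Ck_on (Suc k) S f \<Longrightarrow> Ck_on k S f"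
proof (induction k arbitrary: f)
  case 0
  show ?case using Ck_on_continuous_on[OF 0] by simp
next
  case (Suc k)
  from Suc.prems obtain f' where "\<And>x. x \<in> S \<Longrightarrow> (f has_derivative f' x) (at x within S)"
    and f': "\<And>v. Ck_on (Suc k) S (\<lambda>x. f' x v)" using Ck_on_SucE by blast
  then show ?case using Suc.IH[OF f'] by (rule_tac Ck_on_SucI)
qed

lemma Ck_on_cong:
  assumes "Ck_on k S f" "\<And>x. x \<in> S \<Longrightarrow> g x = f x"
  shows "Ck_on k S g"
proof (cases k)
  case 0
  then show ?thesis using assms continuous_on_cong[of S S g f] by simp
next
  case (Suc j)
  with assms(1) obtain f' where f': "\<forall>x\<in>S. (f has_derivative f' x) (at x within S)"
    "\<forall>v. Ck_on j S (\<lambda>x. f' x v)" by auto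
  have "\<forall>x\<in>S. (g has_derivative f' x) (at x within S)"
    using f'(1) assms(2) has_derivative_transform[of _ S g f] by simp
  with f'(2) Suc show ?thesis by auto
qed

lemma Ck_on_subset: "Ck_on k T f \<Longrightarrow> S \<subseteq> T \<Longrightarrow> Ck_on k S f"
proof (induction k arbitrary: f)
  case 0
  then show ?case using continuous_on_subset by auto
next
  case (Suc k)
  then show ?case by (simp, meson has_derivative_subset subsetD)
qed

lemma Ck_on_const: "Ck_on k S (\<lambda>x. c)"
proof (induction k arbitrary: c)
  case (Suc k)
  show ?case by (rule Ck_on_SucI[where f' = "\<lambda>x v. 0"]) (use Suc in auto)
qed auto

lemma Ck_on_bounded_linear:
  assumes "bounded_linear h" "Ck_on k S f"
  shows "Ck_on k S (\<lambda>x. h (f x))"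
  using assms(2)
proof (induction k arbitrary: f)
  case 0
  then show ?case using bounded_linear.continuous_on[OF assms(1)] by auto
next
  case (Suc k)
  from Suc.prems obtain f' where f': "\<And>x. x \<in> S \<Longrightarrow> (f has_derivative f' x) (at x within S)"
    "\<And>v. Ck_on k S (\<lambda>x. f' x v)" using Ck_on_SucE by blast
  show ?case
    by (rule Ck_on_SucI[where f' = "\<lambda>x v. h (f' x v)"])
      (simp_all add: Suc.IH f' bounded_linear.has_derivative[OF assms(1)])
qed

lemma Ck_on_ident: "Ck_on k S (\<lambda>x. x)"
proof (cases k)
  case (Suc j)
  have "Ck_on (Suc j) S (\<lambda>x. x)"
    by (rule Ck_on_SucI[where f' = "\<lambda>x v. v"]) (auto intro: Ck_on_const)
  then show ?thesis by (simp only: Suc)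
qed auto

lemma Ck_on_add: "Ck_on k S f \<Longrightarrow> Ck_on k S g \<Longrightarrow> Ck_on k S (\<lambda>x. f x + g x)"
proof (induction k arbitrary: f g)
  case 0
  then show ?case by (auto intro: continuous_on_add)
next
  case (Suc k)
  from Suc.prems obtain f' g' where
    "\<forall>x\<in>S. (f has_derivative f' x) (at x within S)" "\<forall>v. Ck_on k S (\<lambda>x. f' x v)"
    "\<forall>x\<in>S. (g has_derivative g' x) (at x within S)" "\<forall>v. Ck_on k S (\<lambda>x. g' x v)" by auto
  then show ?case
    by (intro Ck_on_SucI[where f' = "\<lambda>x v. f' x v + g' x v"]) (simp_all add: Suc.IH has_derivative_add)
qed

lemma Ck_on_bilinear:
  assumes "bounded_bilinear h" "Ck_on k S f" "Ck_on k S g"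
  shows "Ck_on k S (\<lambda>x. h (f x) (g x))"
  using assms(2,3)
proof (induction k arbitrary: f g)
  case 0
  then show ?case using bounded_bilinear.continuous_on[OF assms(1)] by auto
next
  case (Suc k)
  from Suc.prems obtain f' g' where
    *: "\<forall>x\<in>S. (f has_derivative f' x) (at x within S)" "\<forall>v. Ck_on k S (\<lambda>x. f' x v)"
    "\<forall>x\<in>S. (g has_derivative g' x) (at x within S)" "\<forall>v. Ck_on k S (\<lambda>x. g' x v)" by auto
  have "Ck_on k S f" "Ck_on k S g" using Suc.prems Ck_on_Suc_imp by blast+
  with * show ?case
    by (intro Ck_on_SucI[where f' = "\<lambda>x v. h (f x) (g' x v) + h (f' x v) (g x)"])
      (simp_all add: Suc.IH Ck_on_add bounded_bilinear.FDERIV[OF assms(1)])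
qed

lemma Ck_on_sum:
  assumes "finite I" "\<And>i. i \<in> I \<Longrightarrow> Ck_on k S (f i)"
  shows "Ck_on k S (\<lambda>x. \<Sum>i\<in>I. f i x)"
  using assms by (induction I rule: finite_induct) (simp_all add: Ck_on_const Ck_on_add)

lemma linear_expansion:
  fixes h :: "'a::euclidean_space \<Rightarrow> 'b::real_normed_vector"
  assumes "linear h"
  shows "h v = (\<Sum>b\<in>Basis. (v \<bullet> b) *\<^sub>R h b)"
proof -
  have "h v = h (\<Sum>b\<in>Basis. (v \<bullet> b) *\<^sub>R b)" by (simp add: euclidean_representation)
  also have "\<dots> = (\<Sum>b\<in>Basis. (v \<bullet> b) *\<^sub>R h b)"
    by (simp add: linear_sum[OF assms] linear_cmul[OF assms])
  finally show ?thesis .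
qed

text \<open>The chain rule differentiates g in the direction \<open>f' x v\<close>, which moves with
  \<open>x\<close>, while \<open>Ck_on\<close> controls only fixed directions. Expanding the
  direction in \<open>Basis\<close> gives a finite sum of products to which the induction hypothesis
  applies.\<close>

lemma Ck_on_compose:
  fixes f :: "'a::euclidean_space \<Rightarrow> 'b::euclidean_space"
  assumes "Ck_on k T g" "Ck_on k S f" "f ` S \<subseteq> T"
  shows "Ck_on k S (\<lambda>x. g (f x))"
  using assms(1,2)
proof (induction k arbitrary: g)
  case 0
  then show ?case using assms(3) by (auto intro: continuous_on_compose2)
next
  case (Suc k)
  from Suc.prems obtain f' g' where
    *: "\<forall>x\<in>S. (f has_derivative f' x) (at x within S)" "\<forall>v. Ck_on k S (\<lambda>x. f' x v)"
    "\<forall>y\<in>T. (g has_derivative g' y) (at y within T)" "\<forall>v. Ck_on k T (\<lambda>y. g' y v)" by auto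
  have fk: "Ck_on k S f" using Suc.prems Ck_on_Suc_imp by blast
  have d: "((\<lambda>x. g (f x)) has_derivative (\<lambda>v. g' (f x) (f' x v))) (at x within S)"
    if "x \<in> S" for x
    by (rule has_derivative_chain[OF _ _ assms(3)]) (use * that assms(3) in auto)
  have "Ck_on k S (\<lambda>x. g' (f x) (f' x v))" for v
  proof -
    have "Ck_on k S (\<lambda>x. \<Sum>b\<in>Basis. (f' x v \<bullet> b) *\<^sub>R g' (f x) b)"
      by (intro Ck_on_sum Ck_on_bilinear[OF bounded_bilinear_scaleR]
          Ck_on_bounded_linear[OF bounded_linear_inner_left] Suc.IH *(4)[rule_format] *(2)[rule_format] fk) auto
    then show ?thesis
    proof (rule Ck_on_cong)
      fix x assume "x \<in> S"
      then have "linear (g' (f x))"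
        using *(3) assms(3) has_derivative_linear by blast
      then show "g' (f x) (f' x v) = (\<Sum>b\<in>Basis. (f' x v \<bullet> b) *\<^sub>R g' (f x) b)"
        by (rule linear_expansion)
    qed
  qed
  with d show ?case by (rule Ck_on_SucI)
qed

section \<open>Closure rules for smooth functions\<close>

named_theorems smooth_intros

lemma smooth_on_cong:
  "smooth_on S f \<Longrightarrow> (\<And>x. x \<in> S \<Longrightarrow> g x = f x) \<Longrightarrow> smooth_on S g"
  unfolding smooth_on_def using Ck_on_cong by blast

lemma smooth_on_subset: "smooth_on T f \<Longrightarrow> S \<subseteq> T \<Longrightarrow> smooth_on S f"
  unfolding smooth_on_def using Ck_on_subset by blast

lemma smooth_on_continuous_on: "smooth_on S f \<Longrightarrow> continuous_on S f"
  unfolding smooth_on_def using Ck_on_continuous_on by blast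

lemma smooth_on_const [smooth_intros]: "smooth_on S (\<lambda>x. c)"
  unfolding smooth_on_def using Ck_on_const by blast

lemma smooth_on_ident [smooth_intros]: "smooth_on S (\<lambda>x. x)"
  unfolding smooth_on_def using Ck_on_ident by blast

lemma smooth_on_linear:
  "bounded_linear h \<Longrightarrow> smooth_on S f \<Longrightarrow> smooth_on S (\<lambda>x. h (f x))"
  unfolding smooth_on_def using Ck_on_bounded_linear by blast

lemma smooth_on_bilinear:
  "bounded_bilinear h \<Longrightarrow> smooth_on S f \<Longrightarrow> smooth_on S g \<Longrightarrow> smooth_on S (\<lambda>x. h (f x) (g x))"
  unfolding smooth_on_def using Ck_on_bilinear by blast

lemma smooth_on_add [smooth_intros]:
  "smooth_on S f \<Longrightarrow> smooth_on S g \<Longrightarrow> smooth_on S (\<lambda>x. f x + g x)"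
  unfolding smooth_on_def using Ck_on_add by blast

lemma smooth_on_minus [smooth_intros]: "smooth_on S f \<Longrightarrow> smooth_on S (\<lambda>x. - f x)"
  using smooth_on_linear[OF bounded_linear_minus[OF bounded_linear_ident]] .

lemma smooth_on_diff [smooth_intros]:
  "smooth_on S f \<Longrightarrow> smooth_on S g \<Longrightarrow> smooth_on S (\<lambda>x. f x - g x)"
  using smooth_on_add[OF _ smooth_on_minus] by fastforce

lemmas smooth_on_scaleR [smooth_intros] = smooth_on_bilinear[OF bounded_bilinear_scaleR]
lemmas smooth_on_mult [smooth_intros] = smooth_on_bilinear[OF bounded_bilinear_mult]
lemmas smooth_on_inner [smooth_intros] = smooth_on_bilinear[OF bounded_bilinear_inner]
lemmas smooth_on_fst [smooth_intros] = smooth_on_linear[OF bounded_linear_fst]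
lemmas smooth_on_snd [smooth_intros] = smooth_on_linear[OF bounded_linear_snd]

lemma smooth_on_power [smooth_intros]:
  fixes f :: "_ \<Rightarrow> real"
  shows "smooth_on S f \<Longrightarrow> smooth_on S (\<lambda>x. f x ^ n)"
  by (induction n) (simp_all add: smooth_on_const smooth_on_mult)

lemma smooth_on_sum [smooth_intros]:
  "finite I \<Longrightarrow> (\<And>i. i \<in> I \<Longrightarrow> smooth_on S (f i)) \<Longrightarrow> smooth_on S (\<lambda>x. \<Sum>i\<in>I. f i x)"
  unfolding smooth_on_def using Ck_on_sum by blast

lemma smooth_on_prod [smooth_intros]:
  fixes f :: "_ \<Rightarrow> _ \<Rightarrow> real"
  assumes "finite I" "\<And>i. i \<in> I \<Longrightarrow> smooth_on S (f i)"
  shows "smooth_on S (\<lambda>x. \<Prod>i\<in>I. f i x)"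
  using assms by (induction I rule: finite_induct) (simp_all add: smooth_on_const smooth_on_mult)

lemma smooth_on_Pair [smooth_intros]:
  assumes "smooth_on S f" "smooth_on S g"
  shows "smooth_on S (\<lambda>x. (f x, g x))"
proof -
  have "bounded_linear (\<lambda>a. (a, 0))" "bounded_linear (\<lambda>b. (0, b))"
    by (auto intro: bounded_linear_Pair bounded_linear_ident bounded_linear_zero)
  then have "smooth_on S (\<lambda>x. (f x, 0) + (0, g x))"
    by (intro smooth_on_add smooth_on_linear[of "\<lambda>a. (a, 0)"] smooth_on_linear[of "\<lambda>b. (0, b)"] assms)
  then show ?thesis by simp
qed

lemma smooth_on_compose:
  fixes f :: "'a::euclidean_space \<Rightarrow> 'b::euclidean_space"
  shows "smooth_on T g \<Longrightarrow> smooth_on S f \<Longrightarrow> f ` S \<subseteq> T \<Longrightarrow> smooth_on S (\<lambda>x. g (f x))"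
  unfolding smooth_on_def using Ck_on_compose by blast

lemma smooth_on_vec [smooth_intros]:
  fixes f :: "'a::euclidean_space \<Rightarrow> 'n::finite \<Rightarrow> real"
  assumes "\<And>i. smooth_on S (\<lambda>x. f x i)"
  shows "smooth_on S (\<lambda>x. \<chi> i. f x i)"
proof -
  have "smooth_on S (\<lambda>x. \<Sum>i\<in>UNIV. f x i *\<^sub>R axis i (1::real))"
    using assms by (intro smooth_intros) auto
  moreover have "(\<chi> i. f x i) = (\<Sum>i\<in>UNIV. f x i *\<^sub>R axis i (1::real))" for x
    by (simp add: vec_eq_iff axis_def if_distrib cong: if_cong)
  ultimately show ?thesis by simp
qed

lemma smooth_on_vec_nth [smooth_intros]:
  fixes f :: "'a::euclidean_space \<Rightarrow> real^'n"
  shows "smooth_on S f \<Longrightarrow> smooth_on S (\<lambda>x. f x $ i)"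
  using smooth_on_linear[OF bounded_linear_vec_nth] .

lemma Ck_on_sin_cos: "Ck_on k UNIV (sin :: real \<Rightarrow> real) \<and> Ck_on k UNIV (cos :: real \<Rightarrow> real)"
proof (induction k)
  case 0
  then show ?case by (auto intro: continuous_intros)
next
  case (Suc k)
  have "Ck_on (Suc k) UNIV (sin :: real \<Rightarrow> real)"
    by (rule Ck_on_SucI[where f' = "\<lambda>x v. v * cos x"])
      (use Suc in \<open>auto intro!: derivative_eq_intros Ck_on_bilinear[OF bounded_bilinear_mult] Ck_on_const\<close>)
  moreover have "Ck_on k UNIV (\<lambda>x::real. (- v) * sin x)" for v
    using Suc by (intro Ck_on_bilinear[OF bounded_bilinear_mult] Ck_on_const) auto
  then have "Ck_on (Suc k) UNIV (cos :: real \<Rightarrow> real)"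
    by (intro Ck_on_SucI[where f' = "\<lambda>x v. (- v) * sin x"]) (auto intro!: derivative_eq_intros)
  ultimately show ?case by simp
qed

lemma smooth_on_sin [smooth_intros]: "smooth_on S f \<Longrightarrow> smooth_on S (\<lambda>x. sin (f x :: real))"
  and smooth_on_cos [smooth_intros]: "smooth_on S f \<Longrightarrow> smooth_on S (\<lambda>x. cos (f x :: real))"
  using smooth_on_compose[of UNIV _ S f] Ck_on_sin_cos by (auto simp: smooth_on_def)

lemma Ck_on_inverse: "Ck_on k {0<..} (inverse :: real \<Rightarrow> real)"
proof (induction k)
  case 0
  then show ?case by (auto intro!: continuous_intros)
next
  case (Suc k)
  have "Ck_on k {0<..} (\<lambda>x::real. - (inverse x * v * inverse x))" for v
    using Ck_on_bounded_linear[OF bounded_linear_minus[OF bounded_linear_ident]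
       Ck_on_bilinear[OF bounded_bilinear_mult Ck_on_bilinear[OF bounded_bilinear_mult Suc Ck_on_const] Suc]] .
  then show ?case
    by (intro Ck_on_SucI[where f' = "\<lambda>x v. - (inverse x * v * inverse x)"]) (auto intro!: has_derivative_inverse')
qed

lemma smooth_on_inverse [smooth_intros]:
  "smooth_on S f \<Longrightarrow> (\<And>x. x \<in> S \<Longrightarrow> f x > 0) \<Longrightarrow> smooth_on S (\<lambda>x. inverse (f x :: real))"
  using smooth_on_compose[of "{0<..}" inverse S f] Ck_on_inverse by (auto simp: smooth_on_def)

text \<open>The geometric hypothesis of \<open>frechet_derivative_unique_within\<close>: every point
  of the set is approached inside the set along each coordinate axis. Unlike openness, it holds for
  the closed unit interval, and it passes to products.\<close>

definition coord_dense :: "'a::euclidean_space set \<Rightarrow> bool" where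
  "coord_dense S \<longleftrightarrow> (\<forall>x\<in>S. \<forall>b\<in>Basis. \<forall>e>0. \<exists>d. 0 < \<bar>d\<bar> \<and> \<bar>d\<bar> < e \<and> x + d *\<^sub>R b \<in> S)"

lemma coord_dense_unique:
  assumes "coord_dense S" "x \<in> S" "(f has_derivative f') (at x within S)"
    "(f has_derivative f'') (at x within S)"
  shows "f' = f''"
  by (rule frechet_derivative_unique_within[OF assms(3,4)])
    (use assms(1,2) in \<open>auto simp: coord_dense_def\<close>)

lemma coord_dense_open: "open S \<Longrightarrow> coord_dense S"
  unfolding coord_dense_def
proof safe
  fix x b :: 'a and e :: real assume "open S" "x \<in> S" "b \<in> Basis" "e > 0"
  then obtain d where d: "d > 0" "ball x d \<subseteq> S" by (meson open_contains_ball)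
  then have "x + (min d e / 2) *\<^sub>R b \<in> S"
    using \<open>b \<in> Basis\<close> \<open>e > 0\<close> by (intro subsetD[OF d(2)]) (auto simp: dist_norm)
  then show "\<exists>d. 0 < \<bar>d\<bar> \<and> \<bar>d\<bar> < e \<and> x + d *\<^sub>R b \<in> S"
    using d(1) \<open>e > 0\<close> by (intro exI[of _ "min d e / 2"]) auto
qed

lemma coord_dense_Times:
  assumes "coord_dense S" "coord_dense T"
  shows "coord_dense (S \<times> T)"
  unfolding coord_dense_def
proof safe
  fix x :: 'a and y :: 'b and b1 :: 'a and b2 :: 'b and e :: real
  assume xy: "x \<in> S" "y \<in> T" and b: "(b1, b2) \<in> Basis" and e: "e > 0"
  have "(b1 \<in> Basis \<and> b2 = 0) \<or> (b1 = 0 \<and> b2 \<in> Basis)"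
    using b by (auto simp: Basis_prod_def)
  then show "\<exists>d. 0 < \<bar>d\<bar> \<and> \<bar>d\<bar> < e \<and> (x, y) + d *\<^sub>R (b1, b2) \<in> S \<times> T"
    using assms xy e unfolding coord_dense_def by force
qed

lemma coord_dense_01: "coord_dense {0..1::real}"
  unfolding coord_dense_def
proof safe
  fix x b e :: real assume *: "x \<in> {0..1}" "b \<in> Basis" "e > 0"
  show "\<exists>d. 0 < \<bar>d\<bar> \<and> \<bar>d\<bar> < e \<and> x + d *\<^sub>R b \<in> {0..1}"
  \<comment> \<open>A step of length at most 1/2 stays in the interval if it points away from the
    nearer endpoint.\<close>
  proof (cases "x < 1/2")
    case True
    with * show ?thesis by (intro exI[of _ "min e 1 / 2"]) auto
  next
    case False
    with * show ?thesis by (intro exI[of _ "- (min e 1 / 2)"]) auto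
  qed
qed

abbreviation deriv_on :: "'a::euclidean_space set \<Rightarrow> ('a \<Rightarrow> 'b::real_normed_vector) \<Rightarrow> 'a \<Rightarrow> 'a \<Rightarrow> 'b" where
  "deriv_on S f x \<equiv> frechet_derivative f (at x within S)"

lemma smooth_on_has_derivative:
  assumes "smooth_on S f" "x \<in> S"
  shows "(f has_derivative deriv_on S f x) (at x within S)"
proof -
  have "Ck_on (Suc 0) S f" using assms(1) by (simp only: smooth_on_def)
  with assms(2) have "f differentiable (at x within S)"
    unfolding differentiable_def by auto
  then show ?thesis by (simp add: frechet_derivative_works)
qed

lemma smooth_on_deriv_linear:
  "smooth_on S f \<Longrightarrow> x \<in> S \<Longrightarrow> linear (deriv_on S f x)"
  using smooth_on_has_derivative has_derivative_linear by blast

lemma smooth_on_deriv_on_fixed: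
  assumes "coord_dense S" "smooth_on S f"
  shows "smooth_on S (\<lambda>x. deriv_on S f x v)"
  unfolding smooth_on_def
proof
  fix k
  have "Ck_on (Suc k) S f" using assms(2) by (simp only: smooth_on_def)
  then obtain f' where f': "\<forall>x\<in>S. (f has_derivative f' x) (at x within S)"
    "\<forall>v. Ck_on k S (\<lambda>x. f' x v)" by auto
  then have "deriv_on S f x = f' x" if "x \<in> S" for x
    using coord_dense_unique[OF assms(1) that] smooth_on_has_derivative[OF assms(2) that] that by blast
  with f'(2) show "Ck_on k S (\<lambda>x. deriv_on S f x v)" by (auto intro: Ck_on_cong)
qed

text \<open>Here base point and direction both vary, as in L_q.p. The expansion in
  \<open>Basis\<close> separates them: coefficients of the direction times derivatives in fixed
  directions.\<close>

lemma smooth_on_deriv_on [smooth_intros]: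
  fixes f :: "'a::euclidean_space \<Rightarrow> 'b::euclidean_space"
  assumes "coord_dense S" "smooth_on S f" "smooth_on T h" "smooth_on T g"
    and hS: "\<And>y. y \<in> T \<Longrightarrow> h y \<in> S"
  shows "smooth_on T (\<lambda>y. deriv_on S f (h y) (g y))"
proof -
  have "smooth_on T (\<lambda>y. \<Sum>b\<in>Basis. (g y \<bullet> b) *\<^sub>R deriv_on S f (h y) b)"
    using assms by (intro smooth_on_sum smooth_on_scaleR smooth_on_inner smooth_on_const
      smooth_on_compose[OF smooth_on_deriv_on_fixed[OF assms(1,2)]]) auto
  then show ?thesis
    by (rule smooth_on_cong)
      (use hS assms(2) in \<open>simp add: smooth_on_deriv_linear flip: linear_expansion\<close>)
qed

section \<open>Integrals depending on a parameter\<close>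

lemma integral_has_derivative:
  fixes g :: "'a::euclidean_space \<times> real \<Rightarrow> 'b::euclidean_space"
  assumes "convex S"
    and der: "\<And>x. x \<in> S \<times> {0..1} \<Longrightarrow> (g has_derivative g' x) (at x within S \<times> {0..1})"
    and cont: "\<And>v. continuous_on (S \<times> {0..1}) (\<lambda>x. g' x v)"
    and "z \<in> S"
  shows "((\<lambda>z. integral {0..1} (\<lambda>t. g (z, t))) has_derivative
      (\<lambda>v. integral {0..1} (\<lambda>t. g' (z, t) (v, 0)))) (at z within S)"
proof -
  have par: "((\<lambda>z. g (z, t)) has_derivative (\<lambda>v. g' (z, t) (v, 0))) (at z within S)"
    if "z \<in> S" "t \<in> {0..1}" for z t
    by (rule has_derivative_chain[OF der]) (use that in \<open>auto intro!: derivative_eq_intros\<close>)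
  \<comment> \<open>\<open>leibniz_rule\<close> wants the partial derivative as a bounded linear
    function that is continuous in operator norm; in finite dimension continuity for each direction
    suffices. Off the domain nothing is known about \<open>g'\<close>, hence the default 0.\<close>
  define G :: "'a \<Rightarrow> real \<Rightarrow> 'a \<Rightarrow>\<^sub>L 'b" where "G z t = (if (z, t) \<in> S \<times> {0..1} then Blinfun (\<lambda>v. g' (z, t) (v, 0)) else 0)" for z t
  have G: "blinfun_apply (G z t) v = g' (z, t) (v, 0)" if "z \<in> S" "t \<in> {0..1}" for z t v
    using par[OF that] that has_derivative_bounded_linear unfolding G_def
    by (auto simp: bounded_linear_Blinfun_apply)
  have parG: "((\<lambda>z. g (z, t)) has_derivative blinfun_apply (G z t)) (at z within S)"
    if "z \<in> S" "t \<in> {0..1}" for z t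
  proof -
    have "blinfun_apply (G z t) = (\<lambda>v. g' (z, t) (v, 0))" using G[OF that] by blast
    then show ?thesis using par[OF that] by simp
  qed
  have contG: "continuous_on (S \<times> {0..1}) (\<lambda>(z, t). G z t)"
  proof (rule continuous_on_blinfun_componentwise)
    fix i :: 'a
    have "continuous_on (S \<times> {0..1}) (\<lambda>x. g' x (i, 0))" by (rule cont)
    then show "continuous_on (S \<times> {0..1}) (\<lambda>x. blinfun_apply (case x of (z, t) \<Rightarrow> G z t) i)"
      by (rule continuous_on_eq) (auto simp: G)
  qed
  have cg: "continuous_on (S \<times> {0..1}) g" by (rule has_derivative_continuous_on[OF der])
  have contg: "continuous_on {0..1} (\<lambda>t. g (z, t))" if "z \<in> S" for z
    by (rule continuous_on_compose2[OF cg]) (use that in \<open>auto intro!: continuous_intros\<close>)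
  have "((\<lambda>z. integral (cbox 0 1) (\<lambda>t. g (z, t))) has_derivative
      blinfun_apply (integral (cbox 0 1) (G z))) (at z within S)"
    by (rule leibniz_rule[where f="\<lambda>z t. g (z, t)" and fx=G])
      (use assms(1,4) parG contG contg in \<open>auto simp: integrable_continuous_real\<close>)
  moreover have "blinfun_apply (integral (cbox 0 1) (G z)) v = integral {0..1} (\<lambda>t. g' (z, t) (v, 0))" for v
  proof -
    have "continuous_on {0..1} (G z)"
      using continuous_on_compose2[OF contG, of "{0..1}" "\<lambda>t. (z, t)"] \<open>z \<in> S\<close>
        continuous_on_Pair[OF continuous_on_const[of "{0..1}" z] continuous_on_id] by auto
    then have "G z integrable_on cbox 0 1" by (simp add: integrable_continuous_real)
    then have "blinfun_apply (integral (cbox 0 1) (G z)) v = integral (cbox 0 1) (\<lambda>t. blinfun_apply (G z t) v)"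
      by (rule blinfun_apply_integral)
    also have "\<dots> = integral {0..1} (\<lambda>t. g' (z, t) (v, 0))"
      using \<open>z \<in> S\<close> by (auto intro!: integral_cong simp: G)
    finally show ?thesis .
  qed
  then have "blinfun_apply (integral (cbox 0 1) (G z)) = (\<lambda>v. integral {0..1} (\<lambda>t. g' (z, t) (v, 0)))"
    by blast
  ultimately show ?thesis by simp
qed

lemma Ck_on_integral:
  fixes g :: "'a::euclidean_space \<times> real \<Rightarrow> 'b::euclidean_space"
  assumes "convex S" "Ck_on k (S \<times> {0..1}) g"
  shows "Ck_on k S (\<lambda>z. integral {0..1} (\<lambda>t. g (z, t)))"
  using assms(2)
proof (induction k arbitrary: g)
  case 0
  then have "continuous_on (S \<times> cbox 0 1) (\<lambda>(z, t). g (z, t))" by simp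
  from integral_continuous_on_param[OF this] show ?case by simp
next
  case (Suc k)
  then obtain g' where g': "\<forall>x\<in>S \<times> {0..1}. (g has_derivative g' x) (at x within S \<times> {0..1})"
    "\<forall>v. Ck_on k (S \<times> {0..1}) (\<lambda>x. g' x v)" by auto
  then show ?case
    by (intro Ck_on_SucI[where f' = "\<lambda>z v. integral {0..1} (\<lambda>t. g' (z, t) (v, 0))"]
          Suc.IH integral_has_derivative[OF assms(1)])
      (auto intro!: Ck_on_continuous_on[of k])
qed

lemma smooth_on_integral:
  fixes g :: "'a::euclidean_space \<times> real \<Rightarrow> 'b::euclidean_space"
  assumes "convex S" "smooth_on (S \<times> {0..1}) g"
  shows "smooth_on S (\<lambda>z. integral {0..1} (\<lambda>t. g (z, t)))"
  using assms Ck_on_integral unfolding smooth_on_def by blast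

text \<open>Lets the caller supply a hand-computed derivative \<open>e t\<close> for each fixed t.
  By uniqueness on \<open>S\<close> it agrees with the joint derivative of \<open>g\<close> in the
  directions \<open>(v, 0)\<close>.\<close>

lemma smooth_on_integral_has_derivative:
  fixes g :: "'a::euclidean_space \<times> real \<Rightarrow> 'b::euclidean_space"
  assumes "convex S" "coord_dense S" and g: "smooth_on (S \<times> {0..1}) g"
    and e: "\<And>t. t \<in> {0..1} \<Longrightarrow> ((\<lambda>z. g (z, t)) has_derivative e t) (at z within S)"
    and "z \<in> S"
  shows "((\<lambda>z. integral {0..1} (\<lambda>t. g (z, t))) has_derivative
      (\<lambda>v. integral {0..1} (\<lambda>t. e t v))) (at z within S)"
proof -
  let ?g' = "deriv_on (S \<times> {0..1}) g"
  have cd: "coord_dense (S \<times> {0..1::real})" using assms(2) by (rule coord_dense_Times[OF _ coord_dense_01])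
  have 1: "((\<lambda>z. integral {0..1} (\<lambda>t. g (z, t))) has_derivative
      (\<lambda>v. integral {0..1} (\<lambda>t. ?g' (z, t) (v, 0)))) (at z within S)"
    by (rule integral_has_derivative[OF \<open>convex S\<close>])
      (use g cd \<open>z \<in> S\<close> in \<open>auto intro: smooth_on_has_derivative smooth_on_continuous_on smooth_on_deriv_on_fixed\<close>)
  have eq: "(\<lambda>v. ?g' (z, t) (v, 0)) = e t" if "t \<in> {0..1}" for t
  proof (rule coord_dense_unique[OF \<open>coord_dense S\<close> \<open>z \<in> S\<close> _ e[OF that]])
    show "((\<lambda>z. g (z, t)) has_derivative (\<lambda>v. ?g' (z, t) (v, 0))) (at z within S)"
      by (rule has_derivative_chain[OF smooth_on_has_derivative[OF g]])
       (use that \<open>z \<in> S\<close> in \<open>auto intro!: derivative_eq_intros\<close>)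
  qed
  then have "(\<lambda>v. integral {0..1} (\<lambda>t. ?g' (z, t) (v, 0))) = (\<lambda>v. integral {0..1} (\<lambda>t. e t v))"
    by (intro ext integral_cong) (simp add: fun_eq_iff)
  with 1 show ?thesis by simp
qed

section \<open>Bump functions\<close>

text \<open>The classical flat function is the case n = 0. The powers of 1/t are included because
  the linear span of the family is closed under differentiation, so that one induction proves all
  members smooth.\<close>

definition flat_exp :: "nat \<Rightarrow> real \<Rightarrow> real" where
  "flat_exp n t = (if t > 0 then exp (- inverse t) * inverse t ^ n else 0)"

lemma flat_exp_tendsto_0: "(flat_exp n \<longlongrightarrow> 0) (at 0)"
proof (rule filterlim_split_at)
  show "(flat_exp n \<longlongrightarrow> 0) (at_left 0)"
    by (rule tendsto_eventually)
      (auto simp: flat_exp_def eventually_at_left_field intro!: exI[of _ "-1"])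
  \<comment> \<open>With x = 1/t this is the limit of x^n / e^x at infinity.\<close>
  have "((\<lambda>t. inverse t ^ n / exp (inverse t)) \<longlongrightarrow> (0::real)) (at_right 0)"
    using filterlim_compose[OF tendsto_power_div_exp_0 filterlim_inverse_at_top_right] .
  then show "(flat_exp n \<longlongrightarrow> 0) (at_right 0)"
    by (rule Lim_transform_eventually)
      (auto simp: flat_exp_def eventually_at_right_field exp_minus divide_inverse mult.commute
        intro!: exI[of _ 1])
qed

lemma flat_exp_has_derivative:
  "(flat_exp n has_real_derivative flat_exp (n + 2) t - n * flat_exp (n + 1) t) (at t)"
proof (cases t "0::real" rule: linorder_cases)
  case less
  have "((\<lambda>_. 0) has_real_derivative 0) (at t)" by simp
  then have "(flat_exp n has_real_derivative 0) (at t)"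
    by (rule has_field_derivative_transform_within_open[where S = "{..<0}"])
      (use less in \<open>auto simp: flat_exp_def\<close>)
  then show ?thesis using less by (simp add: flat_exp_def)
next
  case equal
  \<comment> \<open>For h other than 0 the difference quotient at the origin is exactly
    \<open>flat_exp (n + 1) h\<close>.\<close>
  have "((\<lambda>h. (flat_exp n (0 + h) - flat_exp n 0) / h) \<longlongrightarrow> 0) (at 0)"
    using flat_exp_tendsto_0[of "n + 1"]
    by (rule Lim_transform_eventually)
      (auto simp: flat_exp_def divide_inverse eventually_at_filter)
  then show ?thesis using equal by (simp add: DERIV_def flat_exp_def)
next
  case greater
  have "((\<lambda>t. exp (- inverse t) * inverse t ^ n) has_real_derivative
      exp (- inverse t) * (inverse t)\<^sup>2 * inverse t ^ n
      - exp (- inverse t) * (n * inverse t ^ (n - 1) * (inverse t)\<^sup>2)) (at t)"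
    using greater by (auto intro!: derivative_eq_intros simp: power2_eq_square algebra_simps)
  also have "exp (- inverse t) * (inverse t)\<^sup>2 * inverse t ^ n
      - exp (- inverse t) * (n * inverse t ^ (n - 1) * (inverse t)\<^sup>2)
      = flat_exp (n + 2) t - n * flat_exp (n + 1) t"
    \<comment> \<open>For n = 0 the truncated exponent \<open>n - 1\<close> is harmless because of
      the factor n.\<close>
    using greater by (cases n) (simp_all add: flat_exp_def power2_eq_square algebra_simps)
  finally show ?thesis
    by (rule has_field_derivative_transform_within_open[where S = "{0<..}"])
      (use greater in \<open>auto simp: flat_exp_def\<close>)
qed

lemma Ck_on_flat_exp: "Ck_on k UNIV (flat_exp n)"
proof (induction k arbitrary: n)
  case 0
  then show ?case
    using flat_exp_has_derivative DERIV_continuous_on[of UNIV "flat_exp n"] by fastforce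
next
  case (Suc k)
  have "Ck_on k UNIV (\<lambda>t. v * (flat_exp (n + 2) t + (- real n) * flat_exp (n + 1) t))" for v
    by (intro Ck_on_add Ck_on_bilinear[OF bounded_bilinear_mult] Ck_on_const Suc)
  moreover have "(flat_exp n has_derivative (\<lambda>v. v * (flat_exp (n + 2) t + (- real n) * flat_exp (n + 1) t)))
      (at t within UNIV)" for t
    using flat_exp_has_derivative[of n t] by (simp add: has_field_derivative_def mult_commute_abs)
  ultimately show ?case by (rule Ck_on_SucI[rotated])
qed

lemma smooth_on_flat_exp [smooth_intros]: "smooth_on S f \<Longrightarrow> smooth_on S (\<lambda>x. flat_exp n (f x))"
  using smooth_on_compose[of UNIV _ S f] Ck_on_flat_exp by (auto simp: smooth_on_def)

definition bump :: "real \<Rightarrow> real \<Rightarrow> real \<Rightarrow> real" where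
  "bump a b s = flat_exp 0 (s - a) * flat_exp 0 (b - s)"

lemma bump_pos: "a < s \<Longrightarrow> s < b \<Longrightarrow> bump a b s > 0"
  by (simp add: bump_def flat_exp_def)

lemma bump_nonneg: "bump a b s \<ge> 0"
  by (simp add: bump_def flat_exp_def)

lemma bump_zero: "s \<notin> {a<..<b} \<Longrightarrow> bump a b s = 0"
  by (auto simp: bump_def flat_exp_def)

lemma smooth_on_bump: "smooth_on S (bump a b)"
  unfolding bump_def[abs_def] by (intro smooth_intros)

text \<open>Two derivatives are enough, since a second-order functional differentiates the variation
  twice. The vanishing of \<open>\<psi>1\<close> outside the interval removes the boundary terms of
  the integration by parts.\<close>

lemma bump_derivs:
  obtains \<psi>1 \<psi>2 where
    "\<And>s. (bump a b has_real_derivative \<psi>1 s) (at s)" "\<And>s. (\<psi>1 has_real_derivative \<psi>2 s) (at s)"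
    "\<And>s. s \<notin> {a<..<b} \<Longrightarrow> \<psi>1 s = 0"
proof -
  \<comment> \<open>For n = 0 the second term in the derivative of \<open>flat_exp n\<close> drops
    out: \<open>flat_exp 0\<close> has derivative \<open>flat_exp 2\<close>.\<close>
  define \<psi>1 where "\<psi>1 s = flat_exp 2 (s - a) * flat_exp 0 (b - s) - flat_exp 0 (s - a) * flat_exp 2 (b - s)" for s
  have d: "((\<lambda>s. flat_exp n (c + m * s)) has_real_derivative
      m * (flat_exp (n + 2) (c + m * s) - n * flat_exp (n + 1) (c + m * s))) (at s)" for n c m s
    by (rule DERIV_cong[OF DERIV_chain2[OF flat_exp_has_derivative]])
      (auto intro!: derivative_eq_intros)
  note d1 = d[of _ "- a" 1, simplified] and d2 = d[of _ b "- 1", simplified]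
  have 1: "(bump a b has_real_derivative \<psi>1 s) (at s)" for s
    using DERIV_mult[OF d1[of 0 s] d2[of 0 s]]
    by (simp add: bump_def[abs_def] \<psi>1_def numeral_2_eq_2 algebra_simps)
  have 2: "\<exists>D. (\<psi>1 has_real_derivative D) (at s)" for s
    using DERIV_diff[OF DERIV_mult[OF d1[of 2 s] d2[of 0 s]] DERIV_mult[OF d1[of 0 s] d2[of 2 s]]]
    unfolding \<psi>1_def[abs_def] by (auto simp: add.commute)
  then obtain \<psi>2 where "\<And>s. (\<psi>1 has_real_derivative \<psi>2 s) (at s)" by metis
  with 1 show ?thesis by (intro that[of \<psi>1 \<psi>2]) (auto simp: \<psi>1_def flat_exp_def)
qed

lemma bump_Cc_infinity:
  assumes "0 < a" "b < 1"
  shows "bump a b \<in> Cc_infinity"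
proof -
  have "closure {s \<in> {0..1}. bump a b s \<noteq> 0} \<subseteq> {a..b}"
  proof (rule closure_minimal)
    show "{s \<in> {0..1}. bump a b s \<noteq> 0} \<subseteq> {a..b}"
      using bump_zero[of _ a b] by (auto simp: greaterThanLessThan_iff) (meson less_imp_le)+
  qed simp
  also have "\<dots> \<subseteq> {0<..<1}" using assms by auto
  finally show ?thesis using smooth_on_bump by (auto simp: Cc_infinity_def)
qed

text \<open>If \<open>Z\<close> is nonzero at an interior point, a bump supported where
  \<open>Z\<close> keeps its sign produces a continuous nonnegative integrand with integral 0 that
  is positive at that point. The endpoints follow by continuity.\<close>

lemma fundamental_lemma_bump:
  fixes Z :: "real \<Rightarrow> real"
  assumes cont: "continuous_on {0..1} Z"
    and int: "\<And>a b. 0 < a \<Longrightarrow> a < b \<Longrightarrow> b < 1 \<Longrightarrow> integral {0..1} (\<lambda>s. bump a b s * Z s) = 0"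
    and "s \<in> {0..1}"
  shows "Z s = 0"
proof -
  have inner: "Z s = 0" if s: "s \<in> {0<..<1}" for s
  proof (rule ccontr)
    assume nz: "Z s \<noteq> 0"
    have "continuous_on {0<..<1} Z" using cont by (rule continuous_on_subset) auto
    then have "isCont Z s" using s by (simp add: continuous_on_eq_continuous_at)
    \<comment> \<open>Multiplying by the constant \<open>Z s\<close> treats both signs at
      once.\<close>
    then have "isCont (\<lambda>t. Z t * Z s) s" by (intro continuous_intros)
    then have "\<forall>\<^sub>F t in at s. 0 < Z t * Z s"
      using nz by (intro order_tendstoD(1)[of _ "Z s * Z s"]) (auto simp: isCont_def zero_less_mult_iff)
    then obtain d where d: "d > 0" "\<And>t. t \<noteq> s \<Longrightarrow> \<bar>t - s\<bar> < d \<Longrightarrow> 0 < Z t * Z s"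
      by (auto simp: eventually_at dist_real_def)
    define e where "e = min d (min s (1 - s)) / 2"
    have e: "e > 0" "e < d" "e < s" "e < 1 - s" using d(1) s by (auto simp: e_def min_def)
    define g where "g t = bump (s - e) (s + e) t * Z t * Z s" for t
    have pos: "0 < Z t * Z s" if "\<bar>t - s\<bar> < d" for t
      using d(2)[of t] nz that by (cases "t = s") (auto simp: zero_less_mult_iff)
    have g0: "0 \<le> g t" for t
    proof (cases "t \<in> {s - e<..<s + e}")
      case True
      then have "0 < Z t * Z s" using e by (intro pos) auto
      then show ?thesis using bump_nonneg[of "s - e" "s + e" t] by (simp add: g_def mult.assoc)
    qed (simp add: g_def bump_zero)
    have contg: "continuous_on {0..1} g"
      unfolding g_def using cont smooth_on_continuous_on[OF smooth_on_bump]
      by (intro continuous_intros)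
    have "integral {0..1} (\<lambda>t. bump (s - e) (s + e) t * Z t) * Z s = 0"
      using int[of "s - e" "s + e"] e by simp
    then have "integral {0..1} g = 0" unfolding g_def integral_mult_left by simp
    then have "(g has_integral 0) (cbox 0 1)"
      using contg integrable_continuous_real[OF contg] by (simp add: has_integral_integral)
    then have "g s = 0"
      by (rule has_integral_0_cbox_imp_0[rotated 2]) (use contg g0 s in auto)
    then show False using bump_pos[of "s - e" s "s + e"] e(1) nz by (simp add: g_def)
  qed
  have "closure {0<..<1::real} = {0..1}" by simp
  with inner cont \<open>s \<in> {0..1}\<close> show ?thesis
    using continuous_constant_on_closure[of "{0<..<1}" Z 0 s] by simp
qed

section \<open>The Euler--Lagrange equation of tangential variations\<close>

text \<open>Resolves the definite description in \<open>gradient\<close>: existence by the Riesz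
  vector built from \<open>Basis\<close>, uniqueness because a vector is determined by its inner
  products.\<close>

lemma gradient_inner:
  fixes f :: "'a::euclidean_space \<Rightarrow> real"
  assumes "(f has_derivative f') (at x)"
  shows "gradient f x \<bullet> h = f' h"
proof -
  let ?D = "\<Sum>b\<in>Basis. f' b *\<^sub>R b"
  have f': "f' h = h \<bullet> ?D" for h
    using linear_expansion[OF has_derivative_linear[OF assms], of h]
    by (simp add: inner_sum_right mult.commute)
  then have "f' = (\<lambda>h. h \<bullet> ?D)" by blast
  then have "GDERIV f x :> ?D" using assms by (simp add: gderiv_def)
  moreover have "D = ?D" if "GDERIV f x :> D" for D
  proof -
    have "f' = (\<lambda>h. h \<bullet> D)" using that assms has_derivative_unique unfolding gderiv_def by blast
    then have "h \<bullet> D = h \<bullet> ?D" for h using f' by (metis (no_types))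
    then show ?thesis by (metis vector_eq_rdot inner_commute)
  qed
  ultimately have "gradient f x = ?D" unfolding gradient_def by blast
  then show ?thesis unfolding f'[of h] by (simp only: inner_commute)
qed

text \<open>The two functions agree only on the unit interval. This is the form needed for second
  derivatives, where \<open>curve_deriv u\<close> is known to equal the first derivative there and
  nowhere else.\<close>

lemma curve_deriv_eq:
  assumes "\<And>s. s \<in> {0..1} \<Longrightarrow> v s = u s"
    and "\<And>s. s \<in> {0..1} \<Longrightarrow> (u has_vector_derivative u' s) (at s within {0..1})" and "s \<in> {0..1}"
  shows "curve_deriv v s = u' s"
proof -
  have "(v has_vector_derivative u' s) (at s within {0..1})"
    by (rule has_vector_derivative_transform[OF assms(3) _ assms(2)[OF assms(3)]]) (use assms(1) in auto)
  then show ?thesis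
    unfolding curve_deriv_def using vector_derivative_within_cbox[of 0 1 s v "u' s"] assms(3) by simp
qed

abbreviation phase_dom :: "(real \<times> (real^'n) \<times> (real^'n) \<times> (real^'n)) set" where
  "phase_dom \<equiv> {0..1} \<times> UNIV \<times> (- {0}) \<times> UNIV"

lemma coord_dense_phase_dom: "coord_dense phase_dom"
  by (intro coord_dense_Times coord_dense_01 coord_dense_open) auto

lemma smooth_on_chain_vector:
  assumes "smooth_on T g" "(c has_vector_derivative c') (at s within S)" "c ` S \<subseteq> T" "s \<in> S"
  shows "((\<lambda>s. g (c s)) has_vector_derivative deriv_on T g (c s) c') (at s within S)"
proof -
  have m: "(g has_derivative deriv_on T g (c s)) (at (c s) within T)"
    using assms by (intro smooth_on_has_derivative) auto
  have "((\<lambda>s. g (c s)) has_derivative (\<lambda>t. deriv_on T g (c s) (t *\<^sub>R c'))) (at s within S)"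
    using has_derivative_chain[OF m _ assms(3)] assms(2) by (simp add: has_vector_derivative_def)
  moreover have "deriv_on T g (c s) (t *\<^sub>R c') = t *\<^sub>R deriv_on T g (c s) c'" for t
    using linear_cmul[OF has_derivative_linear[OF m]] .
  ultimately show ?thesis by (simp add: has_vector_derivative_def)
qed

definition lag :: "(real \<Rightarrow> real^'n \<Rightarrow> real^'n \<Rightarrow> real^'n \<Rightarrow> real) \<Rightarrow>
    real \<times> (real^'n) \<times> (real^'n) \<times> (real^'n) \<Rightarrow> real" where
  "lag L = (\<lambda>(s, u, p, q). L s u p q)"

text \<open>The function B of the overview, the coefficient of psi'' in the first variation.\<close>

definition momentum :: "(real \<Rightarrow> real^'n \<Rightarrow> real^'n \<Rightarrow> real^'n \<Rightarrow> real) \<Rightarrow>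
    real \<times> (real^'n) \<times> (real^'n) \<times> (real^'n) \<Rightarrow> real" where
  "momentum L x = deriv_on phase_dom (lag L) x (0, 0, 0, fst (snd (snd x)))"

text \<open>The function A of the overview. The factor 2 comes from the mixed term of (psi u')''.
  The pair (p, 2q) is also the generator of the scaling p -> c p, q -> c^2 q, the effect of a linear
  change of the parameter.\<close>

definition energy :: "(real \<Rightarrow> real^'n \<Rightarrow> real^'n \<Rightarrow> real^'n \<Rightarrow> real) \<Rightarrow>
    real \<times> (real^'n) \<times> (real^'n) \<times> (real^'n) \<Rightarrow> real" where
  "energy L x =
    deriv_on phase_dom (lag L) x (0, 0, fst (snd (snd x)), 2 *\<^sub>R snd (snd (snd x))) - lag L x"

lemma smooth_lag: "smooth_lagrangian L \<Longrightarrow> smooth_on phase_dom (lag L)"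
  by (simp add: smooth_lagrangian_def lag_def)

lemma smooth_momentum:
  assumes "smooth_lagrangian L"
  shows "smooth_on phase_dom (momentum L)"
proof -
  have "smooth_on phase_dom (\<lambda>x. deriv_on phase_dom (lag L) x (0, 0, 0, fst (snd (snd x))))"
    by (rule smooth_on_deriv_on[OF coord_dense_phase_dom smooth_lag[OF assms] smooth_on_ident])
      (auto intro!: smooth_on_Pair smooth_on_const smooth_on_fst smooth_on_snd smooth_on_ident)
  then show ?thesis by (rule smooth_on_cong) (simp add: momentum_def)
qed

lemma smooth_energy:
  assumes "smooth_lagrangian L"
  shows "smooth_on phase_dom (energy L)"
proof -
  have "smooth_on phase_dom (\<lambda>x. deriv_on phase_dom (lag L) x
      (0, 0, fst (snd (snd x)), 2 *\<^sub>R snd (snd (snd x))))"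
    by (rule smooth_on_deriv_on[OF coord_dense_phase_dom smooth_lag[OF assms] smooth_on_ident])
      (auto intro!: smooth_on_Pair smooth_on_const smooth_on_scaleR smooth_on_fst smooth_on_snd smooth_on_ident)
  from smooth_on_diff[OF this smooth_lag[OF assms]] show ?thesis
    by (rule smooth_on_cong) (simp add: energy_def)
qed

text \<open>Translates the three partial gradients of \<open>first_variation\<close> into one joint
  derivative. The slots of u, p and q range over open sets, so these partial derivatives are
  two-sided even when s is 0 or 1.\<close>

lemma lag_partials:
  fixes L :: "real \<Rightarrow> real^'n \<Rightarrow> real^'n \<Rightarrow> real^'n \<Rightarrow> real"
  assumes L: "smooth_lagrangian L" and s: "s \<in> {0..1}" and p: "p \<noteq> 0"
  shows "gradient (\<lambda>x. L s x p q) u \<bullet> h = deriv_on phase_dom (lag L) (s, u, p, q) (0, h, 0, 0)"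
    and "gradient (\<lambda>x. L s u x q) p \<bullet> h = deriv_on phase_dom (lag L) (s, u, p, q) (0, 0, h, 0)"
    and "gradient (\<lambda>x. L s u p x) q \<bullet> h = deriv_on phase_dom (lag L) (s, u, p, q) (0, 0, 0, h)"
proof -
  let ?F' = "deriv_on phase_dom (lag L) (s, u, p, q)"
  have F': "(lag L has_derivative ?F') (at (s, u, p, q) within phase_dom)"
    by (rule smooth_on_has_derivative[OF smooth_lag[OF L]]) (use s p in auto)
  have "((\<lambda>x. lag L (s, x, p, q)) has_derivative (\<lambda>h. ?F' (0, h, 0, 0))) (at u within UNIV)"
    by (rule has_derivative_chain[where f = "\<lambda>x. (s, x, p, q)", OF F']) (use s p in \<open>auto intro!: derivative_eq_intros simp: zero_prod_def\<close>)
  then show "gradient (\<lambda>x. L s x p q) u \<bullet> h = ?F' (0, h, 0, 0)"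
    by (intro gradient_inner) (simp add: lag_def)
  have at_p: "at p within - {0} = at p" by (rule at_within_open) (use p in auto)
  have "((\<lambda>x. lag L (s, u, x, q)) has_derivative (\<lambda>h. ?F' (0, 0, h, 0))) (at p within - {0})"
    by (rule has_derivative_chain[where f = "\<lambda>x. (s, u, x, q)", OF F']) (use s p in \<open>auto intro!: derivative_eq_intros simp: zero_prod_def\<close>)
  then show "gradient (\<lambda>x. L s u x q) p \<bullet> h = ?F' (0, 0, h, 0)"
    unfolding at_p by (intro gradient_inner) (simp add: lag_def)
  have "((\<lambda>x. lag L (s, u, p, x)) has_derivative (\<lambda>h. ?F' (0, 0, 0, h))) (at q within UNIV)"
    by (rule has_derivative_chain[where f = "\<lambda>x. (s, u, p, x)", OF F']) (use s p in \<open>auto intro!: derivative_eq_intros simp: zero_prod_def\<close>)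
  then show "gradient (\<lambda>x. L s u p x) q \<bullet> h = ?F' (0, 0, 0, h)"
    by (intro gradient_inner) (simp add: lag_def)
qed

lemma first_variation_tangential:
  fixes L :: "real \<Rightarrow> real^'n \<Rightarrow> real^'n \<Rightarrow> real^'n \<Rightarrow> real"
  assumes L: "smooth_lagrangian L" "T_lagrangian L"
    and u: "smooth_on {0..1} u" "smooth_on {0..1} u1"
    and du: "\<And>s. s \<in> {0..1} \<Longrightarrow> (u has_vector_derivative u1 s) (at s within {0..1})"
    and du1: "\<And>s. s \<in> {0..1} \<Longrightarrow> (u1 has_vector_derivative u2 s) (at s within {0..1})"
    and du2: "\<And>s. s \<in> {0..1} \<Longrightarrow> (u2 has_vector_derivative u3 s) (at s within {0..1})"
    and reg: "\<And>s. s \<in> {0..1} \<Longrightarrow> u1 s \<noteq> 0"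
    and \<psi>: "\<psi> \<in> Cc_infinity"
    and d\<psi>: "\<And>s. s \<in> {0..1} \<Longrightarrow> (\<psi> has_real_derivative \<psi>1 s) (at s within {0..1})"
    and d\<psi>1: "\<And>s. s \<in> {0..1} \<Longrightarrow> (\<psi>1 has_real_derivative \<psi>2 s) (at s within {0..1})"
  shows "integral {0..1} (\<lambda>s. deriv_on phase_dom (lag L) (s, u s, u1 s, u2 s)
      (0, \<psi> s *\<^sub>R u1 s, \<psi>1 s *\<^sub>R u1 s + \<psi> s *\<^sub>R u2 s,
       \<psi>2 s *\<^sub>R u1 s + (2 * \<psi>1 s) *\<^sub>R u2 s + \<psi> s *\<^sub>R u3 s)) = 0"
proof -
  define v where "v s = \<psi> s *\<^sub>R u1 s" for s
  define v1 where "v1 s = \<psi>1 s *\<^sub>R u1 s + \<psi> s *\<^sub>R u2 s" for s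
  define v2 where "v2 s = \<psi>2 s *\<^sub>R u1 s + (2 * \<psi>1 s) *\<^sub>R u2 s + \<psi> s *\<^sub>R u3 s" for s
  have dv: "(v has_vector_derivative v1 s) (at s within {0..1})" if "s \<in> {0..1}" for s
    unfolding v_def[abs_def] v1_def using has_vector_derivative_scaleR[OF d\<psi> du1] that
    by (simp add: add.commute)
  have dv1: "(v1 has_vector_derivative v2 s) (at s within {0..1})" if "s \<in> {0..1}" for s
    using has_vector_derivative_add[OF has_vector_derivative_scaleR[OF d\<psi>1 du1]
        has_vector_derivative_scaleR[OF d\<psi> du2]] that
    by (simp add: v1_def[abs_def] v2_def algebra_simps scaleR_2 flip: scaleR_scaleR)
  have cd_u: "curve_deriv u s = u1 s" if "s \<in> {0..1}" for s
    by (rule curve_deriv_eq[OF _ du that]) simp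
  have cd_v: "curve_deriv v s = v1 s" if "s \<in> {0..1}" for s
    by (rule curve_deriv_eq[OF _ dv that]) simp
  have cd_u1: "curve_deriv (curve_deriv u) s = u2 s" if "s \<in> {0..1}" for s
    by (rule curve_deriv_eq[OF _ du1 that]) (rule cd_u)
  have cd_v1: "curve_deriv (curve_deriv v) s = v2 s" if "s \<in> {0..1}" for s
    by (rule curve_deriv_eq[OF _ dv1 that]) (rule cd_v)
  have "u \<in> C4_regular"
    using u(1) reg cd_u by (auto simp: C4_regular_def smooth_on_def)
  moreover have "v \<in> tangential_variations u"
  proof -
    have sm: "smooth_on {0..1} \<psi>" and supp: "closure {s \<in> {0..1}. \<psi> s \<noteq> 0} \<subseteq> {0<..<1}"
      using \<psi> by (auto simp: Cc_infinity_def)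
    have "closure {s \<in> {0..1}. v s \<noteq> 0} \<subseteq> closure {s \<in> {0..1}. \<psi> s \<noteq> 0}"
      by (intro closure_mono) (auto simp: v_def)
    moreover have "smooth_on {0..1} v" unfolding v_def[abs_def] by (intro smooth_intros sm u)
    ultimately have "v \<in> Cc_infinity" using supp by (auto simp: Cc_infinity_def)
    then show ?thesis using \<psi> cd_u by (auto simp: tangential_variations_def v_def)
  qed
  ultimately have "first_variation L u v = 0" using L(2) by (auto simp: T_lagrangian_def)
  moreover have "first_variation L u v = integral {0..1}
      (\<lambda>s. deriv_on phase_dom (lag L) (s, u s, u1 s, u2 s) (0, v s, v1 s, v2 s))"
    unfolding first_variation_def
  proof (rule integral_cong)
    fix s :: real assume s: "s \<in> {0..1}"
    have lin: "linear (deriv_on phase_dom (lag L) (s, u s, u1 s, u2 s))"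
      by (rule smooth_on_deriv_linear[OF smooth_lag[OF L(1)]]) (use s reg in auto)
    have "(0, v s, v1 s, v2 s) = (0, v s, 0, 0) + (0, 0, v1 s, 0) + (0::real, 0, 0, v2 s)" by simp
    then show "(let p = curve_deriv u s; q = curve_deriv (curve_deriv u) s
       in gradient (\<lambda>x. L s x p q) (u s) \<bullet> v s
        + gradient (\<lambda>x. L s (u s) x q) p \<bullet> curve_deriv v s
        + gradient (\<lambda>x. L s (u s) p x) q \<bullet> curve_deriv (curve_deriv v) s)
      = deriv_on phase_dom (lag L) (s, u s, u1 s, u2 s) (0, v s, v1 s, v2 s)"
      unfolding Let_def cd_u[OF s] cd_v[OF s] cd_u1[OF s] cd_v1[OF s] lag_partials[OF L(1) s reg[OF s]]
      by (simp only: linear_add[OF lin])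
  qed
  ultimately show ?thesis by (simp add: v_def v1_def v2_def)
qed

text \<open>The derivatives of momentum and energy along the curve are hypotheses because B' is
  later presented in two ways: first as a function of the third derivative, then as C + A. The
  continuity hypothesis concerns only the combination \<open>Z\<close> that is tested.\<close>

lemma tangential_euler_lagrange:
  fixes L :: "real \<Rightarrow> real^'n \<Rightarrow> real^'n \<Rightarrow> real^'n \<Rightarrow> real"
  assumes L: "smooth_lagrangian L" "T_lagrangian L"
    and u: "smooth_on {0..1} u" "smooth_on {0..1} u1"
    and du: "\<And>s. s \<in> {0..1} \<Longrightarrow> (u has_vector_derivative u1 s) (at s within {0..1})"
    and du1: "\<And>s. s \<in> {0..1} \<Longrightarrow> (u1 has_vector_derivative u2 s) (at s within {0..1})"
    and du2: "\<And>s. s \<in> {0..1} \<Longrightarrow> (u2 has_vector_derivative u3 s) (at s within {0..1})"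
    and reg: "\<And>s. s \<in> {0..1} \<Longrightarrow> u1 s \<noteq> 0"
    and db: "\<And>s. s \<in> {0..1} \<Longrightarrow>
      ((\<lambda>s. momentum L (s, u s, u1 s, u2 s)) has_real_derivative b1 s) (at s within {0..1})"
    and db1: "\<And>s. s \<in> {0..1} \<Longrightarrow> (b1 has_real_derivative b2 s) (at s within {0..1})"
    and da: "\<And>s. s \<in> {0..1} \<Longrightarrow>
      ((\<lambda>s. energy L (s, u s, u1 s, u2 s)) has_real_derivative a1 s) (at s within {0..1})"
    and cont: "continuous_on {0..1}
      (\<lambda>s. b2 s - a1 s - deriv_on phase_dom (lag L) (s, u s, u1 s, u2 s) (1, 0, 0, 0))"
    and "s \<in> {0..1}"
  shows "b2 s = a1 s + deriv_on phase_dom (lag L) (s, u s, u1 s, u2 s) (1, 0, 0, 0)"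
proof -
  define \<gamma> where "\<gamma> s = (s, u s, u1 s, u2 s)" for s
  define F' where "F' s = deriv_on phase_dom (lag L) (\<gamma> s)" for s
  define Z where "Z s = b2 s - a1 s - F' s (1, 0, 0, 0)" for s
  have \<gamma>: "\<gamma> s \<in> phase_dom" if "s \<in> {0..1}" for s using that reg by (auto simp: \<gamma>_def)
  have d\<gamma>: "(\<gamma> has_vector_derivative (1, u1 s, u2 s, u3 s)) (at s within {0..1})" if "s \<in> {0..1}" for s
    unfolding \<gamma>_def[abs_def]
    by (intro has_vector_derivative_Pair has_vector_derivative_id du du1 du2 that)
  have dF: "((\<lambda>s. lag L (\<gamma> s)) has_real_derivative F' s (1, u1 s, u2 s, u3 s)) (at s within {0..1})"
    if "s \<in> {0..1}" for s
    unfolding has_real_derivative_iff_has_vector_derivative F'_def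
    by (rule smooth_on_chain_vector[OF smooth_lag[OF L(1)] d\<gamma>]) (use that \<gamma> in blast)+
  have "Z s = 0"
  proof (rule fundamental_lemma_bump[OF _ _ \<open>s \<in> {0..1}\<close>])
    show "continuous_on {0..1} Z" using cont by (simp add: Z_def F'_def \<gamma>_def)
    fix a b :: real assume ab: "0 < a" "a < b" "b < 1"
    obtain \<psi>1 \<psi>2 where \<psi>: "\<And>s. (bump a b has_real_derivative \<psi>1 s) (at s)"
      "\<And>s. (\<psi>1 has_real_derivative \<psi>2 s) (at s)" "\<And>s. s \<notin> {a<..<b} \<Longrightarrow> \<psi>1 s = 0"
      using bump_derivs by blast
    note \<psi>' = \<psi>(1,2)[THEN has_field_derivative_at_within]
    define \<psi> where "\<psi> = bump a b"
    define I where "I s = F' s (0, \<psi> s *\<^sub>R u1 s, \<psi>1 s *\<^sub>R u1 s + \<psi> s *\<^sub>R u2 s,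
       \<psi>2 s *\<^sub>R u1 s + (2 * \<psi>1 s) *\<^sub>R u2 s + \<psi> s *\<^sub>R u3 s)" for s
    \<comment> \<open>All boundary terms of the integrations by parts in one function: its
      derivative is the first-variation integrand \<open>I\<close> minus \<open>\<psi> Z\<close>.
      One application of the fundamental theorem then replaces the integral of \<open>I\<close> by
      that of \<open>\<psi> Z\<close>.\<close>
    define \<Phi> where "\<Phi> s = \<psi> s * lag L (\<gamma> s) + \<psi>1 s * momentum L (\<gamma> s)
      + \<psi> s * (energy L (\<gamma> s) - b1 s)" for s
    have I: "I s = \<psi> s * F' s (1, u1 s, u2 s, u3 s) - \<psi> s * F' s (1, 0, 0, 0)
        + \<psi>1 s * (energy L (\<gamma> s) + lag L (\<gamma> s)) + \<psi>2 s * momentum L (\<gamma> s)" if "s \<in> {0..1}" for s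
    proof -
      have lin: "linear (F' s)"
        unfolding F'_def by (rule smooth_on_deriv_linear[OF smooth_lag[OF L(1)] \<gamma>[OF that]])
      \<comment> \<open>The variation leaves s fixed. Adding and subtracting \<open>\<psi>\<close>
        times the s-direction exposes \<open>\<psi>\<close> times the velocity of
        \<open>\<gamma>\<close>, hence D_s L, and leaves the directions that define
        \<open>energy\<close> and \<open>momentum\<close>.\<close>
      have eq: "(0, \<psi> s *\<^sub>R u1 s, \<psi>1 s *\<^sub>R u1 s + \<psi> s *\<^sub>R u2 s,
            \<psi>2 s *\<^sub>R u1 s + (2 * \<psi>1 s) *\<^sub>R u2 s + \<psi> s *\<^sub>R u3 s)
          = \<psi> s *\<^sub>R (1::real, u1 s, u2 s, u3 s) - \<psi> s *\<^sub>R (1, 0, 0, 0)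
            + \<psi>1 s *\<^sub>R (0, 0, u1 s, 2 *\<^sub>R u2 s) + \<psi>2 s *\<^sub>R (0, 0, 0, u1 s)"
        by (simp add: algebra_simps)
      show ?thesis
        unfolding I_def eq linear_add[OF lin] linear_diff[OF lin] linear_cmul[OF lin]
        by (simp add: F'_def \<gamma>_def energy_def momentum_def)
    qed
    have d\<Phi>: "(\<Phi> has_real_derivative I s - \<psi> s * Z s) (at s within {0..1})" if s: "s \<in> {0..1}" for s
    proof -
      note d = DERIV_add[OF DERIV_add[OF DERIV_mult[OF \<psi>'(1) dF[OF s]]
          DERIV_mult[OF \<psi>'(2) db[OF s]]] DERIV_mult[OF \<psi>'(1) DERIV_diff[OF da[OF s] db1[OF s]]]]
      show ?thesis
        unfolding \<Phi>_def[abs_def] I[OF s] Z_def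
        by (rule DERIV_cong[OF d[folded \<gamma>_def \<psi>_def]]) (simp add: \<psi>_def algebra_simps)
    qed
    have "((\<lambda>s. I s - \<psi> s * Z s) has_integral \<Phi> 1 - \<Phi> 0) {0..1}"
      by (rule fundamental_theorem_of_calculus)
        (use d\<Phi> in \<open>auto simp: has_real_derivative_iff_has_vector_derivative\<close>)
    moreover have "\<Phi> 1 = 0" "\<Phi> 0 = 0"
      using ab \<psi>(3)[of 0] \<psi>(3)[of 1] by (simp_all add: \<Phi>_def \<psi>_def bump_zero)
    ultimately have 1: "((\<lambda>s. I s - \<psi> s * Z s) has_integral 0) {0..1}" by simp
    have "continuous_on {0..1} (\<lambda>s. \<psi> s * Z s)"
      using cont smooth_on_continuous_on[OF smooth_on_bump]
      by (auto simp: Z_def F'_def \<gamma>_def \<psi>_def intro!: continuous_on_mult)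
    then have 2: "((\<lambda>s. \<psi> s * Z s) has_integral integral {0..1} (\<lambda>s. \<psi> s * Z s)) {0..1}"
      by (intro integrable_integral integrable_continuous_real)
    have "integral {0..1} I = integral {0..1} (\<lambda>s. \<psi> s * Z s)"
      using has_integral_add[OF 1 2] by (simp add: integral_unique)
    moreover have "integral {0..1} I = 0"
      using first_variation_tangential[OF L u du du1 du2 reg bump_Cc_infinity[OF ab(1,3)] \<psi>']
      by (simp add: I_def[abs_def] F'_def \<gamma>_def \<psi>_def)
    ultimately show "integral {0..1} (\<lambda>s. bump a b s * Z s) = 0" by (simp add: \<psi>_def)
  qed
  then show ?thesis by (simp add: Z_def F'_def \<gamma>_def)
qed

section \<open>Regular curves with prescribed jets\<close>

definition regular_curve ::
  "(real \<Rightarrow> real^'n) \<Rightarrow> (real \<Rightarrow> real^'n) \<Rightarrow> (real \<Rightarrow> real^'n) \<Rightarrow> (real \<Rightarrow> real^'n) \<Rightarrow>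
    (real \<Rightarrow> real^'n) \<Rightarrow> bool" where
  "regular_curve u u1 u2 u3 u4 \<longleftrightarrow>
    smooth_on {0..1} u \<and> smooth_on {0..1} u1 \<and> smooth_on {0..1} u2 \<and>
    smooth_on {0..1} u3 \<and> smooth_on {0..1} u4 \<and>
    (\<forall>s. (u has_vector_derivative u1 s) (at s within {0..1})) \<and>
    (\<forall>s. (u1 has_vector_derivative u2 s) (at s within {0..1})) \<and>
    (\<forall>s. (u2 has_vector_derivative u3 s) (at s within {0..1})) \<and>
    (\<forall>s. (u3 has_vector_derivative u4 s) (at s within {0..1})) \<and>
    (\<forall>s\<in>{0..1}. u1 s \<noteq> 0)"

text \<open>A Taylor polynomial may lose regularity: p + (s - s0) q can vanish somewhere in [0,1].
  The linear factor is therefore replaced by the oscillation sin(k (s - s0)) / k, which is small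
  everywhere for large k yet has slope 1 at s0. The terms in a and b are kept small. Both
  \<open>\<delta>\<close> and \<open>c\<close> are chosen before a and b, so that different jets can
  be compared.\<close>

lemma regular_curve_with_jet:
  fixes u0 p q :: "real^'n"
  assumes "p \<noteq> 0" "s0 \<in> {0..1}"
  shows "\<exists>\<delta>>0. \<exists>c. \<forall>a b. norm a < \<delta> \<longrightarrow> norm b < \<delta> \<longrightarrow>
    (\<exists>u u1 u2 u3 u4. regular_curve u u1 u2 u3 u4 \<and>
      u s0 = u0 \<and> u1 s0 = p \<and> u2 s0 = q \<and> u3 s0 = a \<and> u4 s0 = c + b)"
proof -
  \<comment> \<open>Chosen so that |q| / k < |p| / 2; the summand 1 keeps k positive when q =
    0.\<close>
  define k where "k = 1 + 2 * norm q / norm p"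
  have k: "k > 0" unfolding k_def by (simp add: add_pos_nonneg)
  have qk: "norm q / k < norm p / 2"
  proof -
    have "2 * norm q < k * norm p" using assms(1) by (simp add: k_def field_simps)
    then show ?thesis using k by (simp add: field_simps)
  qed
  show ?thesis
  \<comment> \<open>The disturbance of p is below |p| (1/2 + 1/4 + 1/12) < |p|. The shift -k^2 q is
    what the oscillating term contributes to the fourth derivative at s0; to the third it
    contributes 0.\<close>
  proof (intro exI[of _ "norm p / 2"] exI[of _ "- k\<^sup>2 *\<^sub>R q"] conjI allI impI)
    show "norm p / 2 > 0" using assms(1) by simp
    fix a b :: "real^'n" assume ab: "norm a < norm p / 2" "norm b < norm p / 2"
    define u where "u s = u0 + (s - s0) *\<^sub>R p + ((1 - cos (k * (s - s0))) * inverse (k\<^sup>2)) *\<^sub>R q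
      + ((s - s0) ^ 3 * inverse 6) *\<^sub>R a + ((s - s0) ^ 4 * inverse 24) *\<^sub>R b" for s
    define u1 where "u1 s = p + (sin (k * (s - s0)) * inverse k) *\<^sub>R q
      + ((s - s0) ^ 2 * inverse 2) *\<^sub>R a + ((s - s0) ^ 3 * inverse 6) *\<^sub>R b" for s
    define u2 where "u2 s = cos (k * (s - s0)) *\<^sub>R q + (s - s0) *\<^sub>R a
      + ((s - s0) ^ 2 * inverse 2) *\<^sub>R b" for s
    define u3 where "u3 s = (- k * sin (k * (s - s0))) *\<^sub>R q + a + (s - s0) *\<^sub>R b" for s
    define u4 where "u4 s = (- k\<^sup>2 * cos (k * (s - s0))) *\<^sub>R q + b" for s
    let ?I = "\<lambda>s. at s within {0..1}"
    have real_derivs: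
      "((\<lambda>s. s - s0) has_real_derivative 1) (?I s)"
      "((\<lambda>s. (s - s0) ^ 2 * inverse 2) has_real_derivative s - s0) (?I s)"
      "((\<lambda>s. (s - s0) ^ 3 * inverse 6) has_real_derivative (s - s0) ^ 2 * inverse 2) (?I s)"
      "((\<lambda>s. (s - s0) ^ 4 * inverse 24) has_real_derivative (s - s0) ^ 3 * inverse 6) (?I s)"
      "((\<lambda>s. (1 - cos (k * (s - s0))) * inverse (k\<^sup>2)) has_real_derivative sin (k * (s - s0)) * inverse k) (?I s)"
      "((\<lambda>s. sin (k * (s - s0)) * inverse k) has_real_derivative cos (k * (s - s0))) (?I s)"
      "((\<lambda>s. cos (k * (s - s0))) has_real_derivative - k * sin (k * (s - s0))) (?I s)"
      "((\<lambda>s. - k * sin (k * (s - s0))) has_real_derivative - k\<^sup>2 * cos (k * (s - s0))) (?I s)"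
      for s
      using k by (auto intro!: derivative_eq_intros simp: field_simps power2_eq_square power3_eq_cube)
    have scaled: "((\<lambda>s. f s *\<^sub>R v) has_vector_derivative f' *\<^sub>R v) (?I s)"
      if "(f has_real_derivative f') (?I s)" for f f' s and v :: "real^'n"
      using has_vector_derivative_scaleR[OF that has_vector_derivative_const[of v]] by simp
    note terms = real_derivs[THEN scaled] has_vector_derivative_const
    have d1: "(u has_vector_derivative u1 s) (?I s)" for s
      unfolding u_def[abs_def] u1_def
      by (rule has_vector_derivative_eq_rhs, (rule terms has_vector_derivative_add)+) simp
    have d2: "(u1 has_vector_derivative u2 s) (?I s)" for s
      unfolding u1_def[abs_def] u2_def
      by (rule has_vector_derivative_eq_rhs, (rule terms has_vector_derivative_add)+) simp
    have d3: "(u2 has_vector_derivative u3 s) (?I s)" for s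
      unfolding u2_def[abs_def] u3_def
      by (rule has_vector_derivative_eq_rhs, (rule terms has_vector_derivative_add)+) simp
    have d4: "(u3 has_vector_derivative u4 s) (?I s)" for s
      unfolding u3_def[abs_def] u4_def
      by (rule has_vector_derivative_eq_rhs, (rule terms has_vector_derivative_add)+) simp
    have sm: "smooth_on {0..1} u" "smooth_on {0..1} u1" "smooth_on {0..1} u2"
      "smooth_on {0..1} u3" "smooth_on {0..1} u4"
      unfolding u_def[abs_def] u1_def[abs_def] u2_def[abs_def] u3_def[abs_def] u4_def[abs_def]
      by (intro smooth_on_add smooth_on_diff smooth_on_scaleR smooth_on_mult smooth_on_sin smooth_on_cos
          smooth_on_power smooth_on_const smooth_on_ident)+
    have reg: "u1 s \<noteq> 0" if s: "s \<in> {0..1}" for s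
    proof
      assume "u1 s = 0"
      then have "p = - ((sin (k * (s - s0)) * inverse k) *\<^sub>R q
        + ((s - s0) ^ 2 * inverse 2) *\<^sub>R a + ((s - s0) ^ 3 * inverse 6) *\<^sub>R b)"
        by (simp add: u1_def add_eq_0_iff2 add.assoc)
      then have "norm p = norm ((sin (k * (s - s0)) * inverse k) *\<^sub>R q
        + ((s - s0) ^ 2 * inverse 2) *\<^sub>R a + ((s - s0) ^ 3 * inverse 6) *\<^sub>R b)" by (metis norm_minus_cancel)
      also have "\<dots> \<le> \<bar>sin (k * (s - s0)) * inverse k\<bar> * norm q
        + \<bar>(s - s0) ^ 2 * inverse 2\<bar> * norm a + \<bar>(s - s0) ^ 3 * inverse 6\<bar> * norm b"
        by (intro norm_triangle_mono) auto
      also have "\<dots> \<le> inverse k * norm q + inverse 2 * norm a + inverse 6 * norm b"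
      proof (intro add_mono mult_right_mono norm_ge_zero)
        have "\<bar>s - s0\<bar> \<le> 1" using s assms(2) by auto
        then have "\<bar>s - s0\<bar> ^ n \<le> 1" for n by (simp add: power_le_one)
        from this[of 2] this[of 3]
        show "\<bar>(s - s0) ^ 2 * inverse 2\<bar> \<le> inverse 2" "\<bar>(s - s0) ^ 3 * inverse 6\<bar> \<le> inverse 6"
          by (auto simp: abs_mult power_abs)
        show "\<bar>sin (k * (s - s0)) * inverse k\<bar> \<le> inverse k"
          using k mult_right_mono[OF abs_sin_le_one[of "k * (s - s0)"], of "inverse k"]
          by (simp add: abs_mult)
      qed
      also have "\<dots> = norm q / k + norm a / 2 + norm b / 6"
        unfolding divide_inverse_commute by (rule refl)
      also have "\<dots> < norm p" using qk ab norm_ge_zero[of a] by linarith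
      finally show False by simp
    qed
    have "u s0 = u0" "u1 s0 = p" "u2 s0 = q" "u3 s0 = a" "u4 s0 = - k\<^sup>2 *\<^sub>R q + b"
      by (simp_all add: u_def u1_def u2_def u3_def u4_def)
    moreover have "regular_curve u u1 u2 u3 u4"
      unfolding regular_curve_def using d1 d2 d3 d4 sm reg by blast
    ultimately show "\<exists>u u1 u2 u3 u4. regular_curve u u1 u2 u3 u4 \<and>
      u s0 = u0 \<and> u1 s0 = p \<and> u2 s0 = q \<and> u3 s0 = a \<and> u4 s0 = - k\<^sup>2 *\<^sub>R q + b" by blast
  qed
qed

lemma regular_curve_lift:
  assumes "regular_curve u u1 u2 u3 u4"
  shows "s \<in> {0..1} \<Longrightarrow> (s, u s, u1 s, u2 s) \<in> phase_dom"
    and "smooth_on {0..1} (\<lambda>s. (s, u s, u1 s, u2 s))"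
    and "((\<lambda>s. (s, u s, u1 s, u2 s)) has_vector_derivative (1, u1 s, u2 s, u3 s)) (at s within {0..1})"
  using assms unfolding regular_curve_def
  by (auto intro!: smooth_on_Pair smooth_on_ident has_vector_derivative_Pair)

text \<open>Passes from the small ball of available jets to all vectors, by rescaling
  \<open>w\<close> into the ball.\<close>

lemma linear_zero_if_zero_near:
  fixes h :: "'a::real_normed_vector \<Rightarrow> 'b::real_vector"
  assumes "linear h" "\<delta> > 0" "\<And>w. norm w < \<delta> \<Longrightarrow> h w = 0"
  shows "h w = 0"
proof -
  define t where "t = \<delta> / (2 * (norm w + 1))"
  have t: "t > 0" using assms(2) by (auto simp: t_def intro!: divide_pos_pos add_nonneg_pos)
  have "norm (t *\<^sub>R w) = \<delta> * (norm w / (2 * (norm w + 1)))"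
    using \<open>\<delta> > 0\<close> by (simp add: t_def)
  also have "\<dots> < \<delta> * 1"
    using assms(2) by (intro mult_strict_left_mono) (auto simp: divide_less_eq add_nonneg_pos)
  finally have "h (t *\<^sub>R w) = 0" using assms(3) by simp
  then show ?thesis using t by (simp add: linear_cmul[OF assms(1)])
qed

text \<open>
  Along a curve, the Euler--Lagrange expression contains the fourth derivative only through
  the \<open>q\<close>-derivative of the momentum.
\<close>

lemma momentum_q_deriv:
  fixes L :: "real \<Rightarrow> real^'n \<Rightarrow> real^'n \<Rightarrow> real^'n \<Rightarrow> real"
  assumes L: "smooth_lagrangian L" "T_lagrangian L" and x: "x \<in> phase_dom"
  shows "deriv_on phase_dom (momentum L) x (0, 0, 0, w) = 0"
proof -
  obtain s0 u0 p q where x_eq: "x = (s0, u0, p, q)" by (cases x)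
  have s0: "s0 \<in> {0..1}" and p: "p \<noteq> 0" using x by (auto simp: x_eq)
  let ?B' = "deriv_on phase_dom (momentum L)"
  let ?E = "phase_dom \<times> (UNIV :: (real^'n) set)"
  \<comment> \<open>The derivative of the momentum along a curve, as a function of the point and of
    the third derivative \<open>w\<close>. Its own derivative along the curve is B'', in which the
    fourth derivative fills the \<open>w\<close>-slot.\<close>
  define H where "H = (\<lambda>(x, w). ?B' x (1, fst (snd (snd x)), snd (snd (snd x)), w))"
  have cdE: "coord_dense ?E"
    by (intro coord_dense_Times coord_dense_phase_dom coord_dense_open open_UNIV)
  have smH: "smooth_on ?E H"
  proof -
    have "smooth_on ?E (\<lambda>y. ?B' (fst y) (1, fst (snd (snd (fst y))), snd (snd (snd (fst y))), snd y))"
      by (rule smooth_on_deriv_on[OF coord_dense_phase_dom smooth_momentum[OF L(1)]])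
        (auto intro!: smooth_on_Pair smooth_on_const smooth_on_fst smooth_on_snd smooth_on_ident)
    then show ?thesis by (simp add: H_def case_prod_unfold)
  qed
  let ?H' = "deriv_on ?E H"
  \<comment> \<open>For fixed x, \<open>H\<close> is affine in \<open>w\<close> with linear part the
    q-derivative of the momentum.\<close>
  have H'_w: "?H' (x, a) (0, w) = ?B' x (0, 0, 0, w)" for a w
  proof -
    have 1: "((\<lambda>w. H (x, w)) has_derivative (\<lambda>w. ?H' (x, a) (0, w))) (at a within UNIV)"
      by (rule has_derivative_chain[where f = "\<lambda>w. (x, w)", OF smooth_on_has_derivative[OF smH]])
        (use x in \<open>auto intro!: derivative_eq_intros\<close>)
    have lin: "linear (?B' x)" by (rule smooth_on_deriv_linear[OF smooth_momentum[OF L(1)] x])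
    have "bounded_linear (\<lambda>w. ?B' x (0, 0, 0, w))"
      unfolding linear_conv_bounded_linear[symmetric]
      by (intro linear_compose[OF _ lin, unfolded o_def]) (auto intro!: linearI)
    then have "((\<lambda>w. ?B' x (1, p, q, 0) + ?B' x (0, 0, 0, w)) has_derivative (\<lambda>w. ?B' x (0, 0, 0, w))) (at a)"
      by (auto intro!: derivative_eq_intros bounded_linear_imp_has_derivative)
    moreover have "H (x, w) = ?B' x (1, p, q, 0) + ?B' x (0, 0, 0, w)" for w
      using linear_add[OF lin, of "(1, p, q, 0)" "(0, 0, 0, w)"] by (simp add: H_def x_eq)
    ultimately have "(\<lambda>w. ?H' (x, a) (0, w)) = (\<lambda>w. ?B' x (0, 0, 0, w))"
      using 1 has_derivative_unique by simp
    then show ?thesis by meson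
  qed
  obtain \<delta> c where \<delta>: "\<delta> > 0" and jet: "\<forall>a b. norm a < \<delta> \<longrightarrow> norm b < \<delta> \<longrightarrow>
    (\<exists>u u1 u2 u3 u4. regular_curve u u1 u2 u3 u4 \<and>
      u s0 = u0 \<and> u1 s0 = p \<and> u2 s0 = q \<and> u3 s0 = a \<and> u4 s0 = c + b)"
    using regular_curve_with_jet[OF p s0, of u0 q] by blast
  \<comment> \<open>The third derivative is held at 0, so the right-hand side is the same for every
    \<open>b\<close>.\<close>
  have el: "?H' (x, 0) ((1, p, q, 0), c + b) = deriv_on phase_dom (energy L) x (1, p, q, 0)
      + deriv_on phase_dom (lag L) x (1, 0, 0, 0)" if b: "norm b < \<delta>" for b
  proof -
    obtain u u1 u2 u3 u4 where curve: "regular_curve u u1 u2 u3 u4"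
      and j: "u s0 = u0" "u1 s0 = p" "u2 s0 = q" "u3 s0 = 0" "u4 s0 = c + b"
      using jet[rule_format, of 0 b] \<delta> b by auto
    then have
      sm: "smooth_on {0..1} u" "smooth_on {0..1} u1" "smooth_on {0..1} u2"
        "smooth_on {0..1} u3" "smooth_on {0..1} u4"
      and d: "\<And>s. (u has_vector_derivative u1 s) (at s within {0..1})"
        "\<And>s. (u1 has_vector_derivative u2 s) (at s within {0..1})"
        "\<And>s. (u2 has_vector_derivative u3 s) (at s within {0..1})"
        "\<And>s. (u3 has_vector_derivative u4 s) (at s within {0..1})"
      and reg: "\<And>s. s \<in> {0..1} \<Longrightarrow> u1 s \<noteq> 0"
      by (auto simp: regular_curve_def)
    define \<gamma> where "\<gamma> s = (s, u s, u1 s, u2 s)" for s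
    note \<gamma> = regular_curve_lift(1)[OF curve, folded \<gamma>_def]
      and sm\<gamma> = regular_curve_lift(2)[OF curve, folded \<gamma>_def]
      and d\<gamma> = regular_curve_lift(3)[OF curve, folded \<gamma>_def]
    have H\<gamma>: "H (\<gamma> s, u3 s) = ?B' (\<gamma> s) (1, u1 s, u2 s, u3 s)" for s by (simp add: H_def \<gamma>_def)
    have cont: "continuous_on {0..1} (\<lambda>s. ?H' (\<gamma> s, u3 s) ((1, u1 s, u2 s, u3 s), u4 s)
        - deriv_on phase_dom (energy L) (\<gamma> s) (1, u1 s, u2 s, u3 s)
        - deriv_on phase_dom (lag L) (\<gamma> s) (1, 0, 0, 0))"
      by (intro smooth_on_continuous_on smooth_on_diff smooth_on_deriv_on[OF cdE smH]
          smooth_on_deriv_on[OF coord_dense_phase_dom smooth_energy[OF L(1)]]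
          smooth_on_deriv_on[OF coord_dense_phase_dom smooth_lag[OF L(1)]]
          smooth_on_Pair smooth_on_const sm sm\<gamma>) (use \<gamma> in auto)
    have "?H' (\<gamma> s0, u3 s0) ((1, u1 s0, u2 s0, u3 s0), u4 s0)
        = deriv_on phase_dom (energy L) (\<gamma> s0) (1, u1 s0, u2 s0, u3 s0)
        + deriv_on phase_dom (lag L) (\<gamma> s0) (1, 0, 0, 0)"
      unfolding \<gamma>_def
    proof (rule tangential_euler_lagrange[OF L sm(1,2) d(1,2,3) reg _ _ _ _ s0])
      fix s :: real assume s: "s \<in> {0..1}"
      show "((\<lambda>s. momentum L (s, u s, u1 s, u2 s)) has_real_derivative H (\<gamma> s, u3 s)) (at s within {0..1})"
        unfolding H\<gamma> has_real_derivative_iff_has_vector_derivative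
        using smooth_on_chain_vector[OF smooth_momentum[OF L(1)] d\<gamma>[of s] _ s] \<gamma> unfolding \<gamma>_def by blast
      show "((\<lambda>s. energy L (s, u s, u1 s, u2 s)) has_real_derivative
          deriv_on phase_dom (energy L) (s, u s, u1 s, u2 s) (1, u1 s, u2 s, u3 s)) (at s within {0..1})"
        unfolding has_real_derivative_iff_has_vector_derivative
        using smooth_on_chain_vector[OF smooth_energy[OF L(1)] d\<gamma>[of s] _ s] \<gamma> unfolding \<gamma>_def by blast
      have "((\<lambda>s. (\<gamma> s, u3 s)) has_vector_derivative ((1, u1 s, u2 s, u3 s), u4 s)) (at s within {0..1})"
        by (intro has_vector_derivative_Pair d\<gamma> d)
      from smooth_on_chain_vector[OF smH this _ s] \<gamma>
      show "((\<lambda>s. H (\<gamma> s, u3 s)) has_real_derivative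
          ?H' ((s, u s, u1 s, u2 s), u3 s) ((1, u1 s, u2 s, u3 s), u4 s)) (at s within {0..1})"
        unfolding has_real_derivative_iff_has_vector_derivative \<gamma>_def by blast
    qed (assumption | rule cont[unfolded \<gamma>_def])+
    then show ?thesis by (simp add: \<gamma>_def j x_eq)
  qed
  have lin: "linear (?H' (x, 0))" by (rule smooth_on_deriv_linear[OF smH]) (use x in auto)
  have "?B' x (0, 0, 0, b) = 0" if "norm b < \<delta>" for b
  proof -
    \<comment> \<open>Comparing the fourth derivatives c + b and c isolates the contribution of
      \<open>b\<close>.\<close>
    have "((1::real, p, q, 0::real^'n), c + b) = ((1, p, q, 0), c + 0) + (0, b)" by simp
    then have "?H' (x, 0) ((1, p, q, 0), c + b) = ?H' (x, 0) ((1, p, q, 0), c + 0) + ?H' (x, 0) (0, b)"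
      by (metis linear_add[OF lin])
    then show ?thesis using el[OF that] el[of 0] \<delta> H'_w by simp
  qed
  moreover have "linear (\<lambda>w. ?B' x (0, 0, 0, w))"
    by (intro linear_compose[OF _ smooth_on_deriv_linear[OF smooth_momentum[OF L(1)] x], unfolded o_def])
      (auto intro!: linearI)
  ultimately show ?thesis using linear_zero_if_zero_near[of "\<lambda>w. ?B' x (0, 0, 0, w)" \<delta> w] \<delta> by blast
qed

text \<open>The function C = B' - A of the overview. The slot of the third derivative can be filled
  with 0 because \<open>momentum_q_deriv\<close> makes B' insensitive to it.\<close>

definition charge :: "(real \<Rightarrow> real^'n \<Rightarrow> real^'n \<Rightarrow> real^'n \<Rightarrow> real) \<Rightarrow>
    real \<times> (real^'n) \<times> (real^'n) \<times> (real^'n) \<Rightarrow> real" where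
  "charge L x =
    deriv_on phase_dom (momentum L) x (1, fst (snd (snd x)), snd (snd (snd x)), 0) - energy L x"

lemma smooth_charge:
  assumes "smooth_lagrangian L"
  shows "smooth_on phase_dom (charge L)"
proof -
  have "smooth_on phase_dom (\<lambda>x. deriv_on phase_dom (momentum L) x
      (1, fst (snd (snd x)), snd (snd (snd x)), 0))"
    by (rule smooth_on_deriv_on[OF coord_dense_phase_dom smooth_momentum[OF assms] smooth_on_ident])
      (auto intro!: smooth_on_Pair smooth_on_const smooth_on_fst smooth_on_snd smooth_on_ident)
  from smooth_on_diff[OF this smooth_energy[OF assms]] show ?thesis
    by (rule smooth_on_cong) (simp add: charge_def)
qed

text \<open>With B' = C + A the Euler-Lagrange equation becomes C' = L_s, whose left side is affine
  in the third derivative \<open>a\<close> and whose right side does not contain it. The value a = 0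
  gives the transport equation, comparison with small \<open>a\<close> the vanishing
  q-derivative.\<close>

lemma charge_derivs:
  fixes L :: "real \<Rightarrow> real^'n \<Rightarrow> real^'n \<Rightarrow> real^'n \<Rightarrow> real"
  assumes L: "smooth_lagrangian L" "T_lagrangian L" and x: "(s0, u0, p, q) \<in> phase_dom"
  shows charge_q_deriv: "deriv_on phase_dom (charge L) (s0, u0, p, q) (0, 0, 0, w) = 0"
    and charge_transport: "deriv_on phase_dom (charge L) (s0, u0, p, q) (1, p, q, 0)
      = deriv_on phase_dom (lag L) (s0, u0, p, q) (1, 0, 0, 0)"
proof -
  let ?C' = "deriv_on phase_dom (charge L)" and ?A' = "deriv_on phase_dom (energy L)"
    and ?B' = "deriv_on phase_dom (momentum L)"
  let ?x = "(s0, u0, p, q)"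
  have s0: "s0 \<in> {0..1}" and p: "p \<noteq> 0" using x by auto
  obtain \<delta> c where \<delta>: "\<delta> > 0" and jet: "\<forall>a b. norm a < \<delta> \<longrightarrow> norm b < \<delta> \<longrightarrow>
    (\<exists>u u1 u2 u3 u4. regular_curve u u1 u2 u3 u4 \<and>
      u s0 = u0 \<and> u1 s0 = p \<and> u2 s0 = q \<and> u3 s0 = a \<and> u4 s0 = c + b)"
    using regular_curve_with_jet[OF p s0, of u0 q] by blast
  have el: "?C' ?x (1, p, q, a) = deriv_on phase_dom (lag L) ?x (1, 0, 0, 0)" if a: "norm a < \<delta>" for a
  proof -
    obtain u u1 u2 u3 u4 where curve: "regular_curve u u1 u2 u3 u4"
      and j: "u s0 = u0" "u1 s0 = p" "u2 s0 = q" "u3 s0 = a"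
      using jet[rule_format, of a 0] \<delta> a by auto
    then have
      sm: "smooth_on {0..1} u" "smooth_on {0..1} u1" "smooth_on {0..1} u2" "smooth_on {0..1} u3"
      and d: "\<And>s. (u has_vector_derivative u1 s) (at s within {0..1})"
        "\<And>s. (u1 has_vector_derivative u2 s) (at s within {0..1})"
        "\<And>s. (u2 has_vector_derivative u3 s) (at s within {0..1})"
      and reg: "\<And>s. s \<in> {0..1} \<Longrightarrow> u1 s \<noteq> 0"
      by (auto simp: regular_curve_def)
    define \<gamma> where "\<gamma> s = (s, u s, u1 s, u2 s)" for s
    define v where "v s = (1::real, u1 s, u2 s, u3 s)" for s
    note \<gamma> = regular_curve_lift(1)[OF curve, folded \<gamma>_def]
      and sm\<gamma> = regular_curve_lift(2)[OF curve, folded \<gamma>_def]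
      and d\<gamma> = regular_curve_lift(3)[OF curve, folded \<gamma>_def v_def]
    have smv: "smooth_on {0..1} v" unfolding v_def[abs_def] by (intro smooth_on_Pair smooth_on_const sm)
    have dC: "((\<lambda>s. charge L (\<gamma> s)) has_real_derivative ?C' (\<gamma> s) (v s)) (at s within {0..1})"
      and dA: "((\<lambda>s. energy L (\<gamma> s)) has_real_derivative ?A' (\<gamma> s) (v s)) (at s within {0..1})"
      and dB: "((\<lambda>s. momentum L (\<gamma> s)) has_real_derivative ?B' (\<gamma> s) (v s)) (at s within {0..1})"
      if s: "s \<in> {0..1}" for s
      unfolding has_real_derivative_iff_has_vector_derivative
      using smooth_on_chain_vector[OF smooth_charge[OF L(1)] d\<gamma>[of s] _ s]
        smooth_on_chain_vector[OF smooth_energy[OF L(1)] d\<gamma>[of s] _ s]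
        smooth_on_chain_vector[OF smooth_momentum[OF L(1)] d\<gamma>[of s] _ s] \<gamma> by blast+
    \<comment> \<open>The third derivative is split off from the velocity; its contribution vanishes
      by \<open>momentum_q_deriv\<close>.\<close>
    have B'_eq: "?B' (\<gamma> s) (v s) = charge L (\<gamma> s) + energy L (\<gamma> s)" if "s \<in> {0..1}" for s
    proof -
      have "linear (?B' (\<gamma> s))"
        by (rule smooth_on_deriv_linear[OF smooth_momentum[OF L(1)] \<gamma>[OF that]])
      from linear_add[OF this, of "(1, u1 s, u2 s, 0)" "(0, 0, 0, u3 s)"]
      show ?thesis
        using momentum_q_deriv[OF L \<gamma>[OF that]] by (simp add: charge_def v_def \<gamma>_def)
    qed
    have cont: "continuous_on {0..1} (\<lambda>s. (?C' (\<gamma> s) (v s) + ?A' (\<gamma> s) (v s)) - ?A' (\<gamma> s) (v s)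
        - deriv_on phase_dom (lag L) (\<gamma> s) (1, 0, 0, 0))"
      by (intro smooth_on_continuous_on smooth_on_add smooth_on_diff
          smooth_on_deriv_on[OF coord_dense_phase_dom smooth_charge[OF L(1)]]
          smooth_on_deriv_on[OF coord_dense_phase_dom smooth_energy[OF L(1)]]
          smooth_on_deriv_on[OF coord_dense_phase_dom smooth_lag[OF L(1)]]
          smooth_on_const sm\<gamma> smv) (use \<gamma> in auto)
    have "?C' (\<gamma> s0) (v s0) + ?A' (\<gamma> s0) (v s0) = ?A' (\<gamma> s0) (v s0)
        + deriv_on phase_dom (lag L) (s0, u s0, u1 s0, u2 s0) (1, 0, 0, 0)"
    proof (rule tangential_euler_lagrange[OF L sm(1,2) d reg _ _ _ _ s0])
      fix s :: real assume s: "s \<in> {0..1}"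
      show "((\<lambda>s. momentum L (s, u s, u1 s, u2 s)) has_real_derivative
          charge L (\<gamma> s) + energy L (\<gamma> s)) (at s within {0..1})"
        using dB[OF s] unfolding B'_eq[OF s] by (simp only: \<gamma>_def)
      show "((\<lambda>s. charge L (\<gamma> s) + energy L (\<gamma> s)) has_real_derivative
          ?C' (\<gamma> s) (v s) + ?A' (\<gamma> s) (v s)) (at s within {0..1})"
        by (intro DERIV_add dC dA s)
      show "((\<lambda>s. energy L (s, u s, u1 s, u2 s)) has_real_derivative ?A' (\<gamma> s) (v s))
          (at s within {0..1})"
        using dA[OF s] by (simp only: \<gamma>_def)
    qed (assumption | rule cont[folded \<gamma>_def] | simp only: cont[unfolded \<gamma>_def] \<gamma>_def)+
    then show ?thesis by (simp add: \<gamma>_def v_def j)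
  qed
  have lin: "linear (?C' ?x)" by (rule smooth_on_deriv_linear[OF smooth_charge[OF L(1)] x])
  from el[of 0] \<delta> show "?C' ?x (1, p, q, 0) = deriv_on phase_dom (lag L) ?x (1, 0, 0, 0)" by simp
  then have "?C' ?x (0, 0, 0, a) = 0" if "norm a < \<delta>" for a
    using el[OF that] linear_add[OF lin, of "(1, p, q, 0)" "(0, 0, 0, a)"] by simp
  moreover have "linear (\<lambda>w. ?C' ?x (0, 0, 0, w))"
    by (intro linear_compose[OF _ lin, unfolded o_def]) (auto intro!: linearI)
  ultimately show "?C' ?x (0, 0, 0, w) = 0"
    using linear_zero_if_zero_near[of "\<lambda>w. ?C' ?x (0, 0, 0, w)" \<delta> w] \<delta> by blast
qed

text \<open>Each q-fibre is a whole vector space, on which a zero derivative forces constancy. Hence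
  g = g o T for the linear projection T that sets q to 0, and differentiating this identity gives
  the second claim.\<close>

lemma q_independent:
  fixes g :: "real \<times> (real^'n) \<times> (real^'n) \<times> (real^'n) \<Rightarrow> real"
  assumes g: "smooth_on phase_dom g"
    and g0: "\<And>x w. x \<in> phase_dom \<Longrightarrow> deriv_on phase_dom g x (0, 0, 0, w) = 0"
    and x: "(s, u, p, q) \<in> phase_dom"
  shows "g (s, u, p, q) = g (s, u, p, 0)"
    and "deriv_on phase_dom g (s, u, p, q) (a, b, c, d) = deriv_on phase_dom g (s, u, p, 0) (a, b, c, 0)"
proof -
  have indep: "g (s, u, p, q) = g (s, u, p, 0)" if "(s, u, p, q) \<in> phase_dom" for s u p q
  proof (rule has_derivative_zero_unique[of UNIV "\<lambda>q. g (s, u, p, q)"])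
    fix q' :: "real^'n"
    have x': "(s, u, p, q') \<in> phase_dom" using that by auto
    have "((\<lambda>q. g (s, u, p, q)) has_derivative
        (\<lambda>h. deriv_on phase_dom g (s, u, p, q') (0, 0, 0, h))) (at q' within UNIV)"
      by (rule has_derivative_chain[where f = "\<lambda>q. (s, u, p, q)", OF smooth_on_has_derivative[OF g x']])
        (use that in \<open>auto intro!: derivative_eq_intros simp: zero_prod_def\<close>)
    then show "((\<lambda>q. g (s, u, p, q)) has_derivative (\<lambda>h. 0)) (at q' within UNIV)"
      by (simp add: g0[OF x'])
  qed auto
  from indep[OF x] show "g (s, u, p, q) = g (s, u, p, 0)" .
  define T :: "real \<times> (real^'n) \<times> (real^'n) \<times> (real^'n) \<Rightarrow> _"
    where "T y = (fst y, fst (snd y), fst (snd (snd y)), 0 :: real^'n)" for y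
  have T: "T y \<in> phase_dom" if "y \<in> phase_dom" for y using that by (auto simp: T_def)
  have bT: "bounded_linear T"
    unfolding T_def[abs_def]
    by (intro bounded_linear_Pair bounded_linear_fst bounded_linear_zero
        bounded_linear_compose[OF bounded_linear_fst] bounded_linear_snd
        bounded_linear_compose[OF bounded_linear_snd])
  have indepT: "g y = g (T y)" if y: "y \<in> phase_dom" for y
  proof -
    obtain s u p q where "y = (s, u, p, q)" by (cases y)
    then show ?thesis using indep[of s u p q] y by (simp only: T_def fst_conv snd_conv)
  qed
  have "((\<lambda>y. g (T y)) has_derivative (\<lambda>v. deriv_on phase_dom g (T (s, u, p, q)) (T v)))
      (at (s, u, p, q) within phase_dom)"
    by (rule has_derivative_chain[OF smooth_on_has_derivative[OF g T[OF x]] bounded_linear_imp_has_derivative[OF bT]])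
      (use T in blast)
  then have "(g has_derivative (\<lambda>v. deriv_on phase_dom g (T (s, u, p, q)) (T v)))
      (at (s, u, p, q) within phase_dom)"
    by (rule has_derivative_transform[where f = "\<lambda>y. g (T y)", OF x, rotated]) (rule indepT)
  from coord_dense_unique[OF coord_dense_phase_dom x smooth_on_has_derivative[OF g x] this]
  show "deriv_on phase_dom g (s, u, p, q) (a, b, c, d) = deriv_on phase_dom g (s, u, p, 0) (a, b, c, 0)"
    by (simp add: T_def)
qed

section \<open>Identities between L, B and C\<close>

context
  fixes L :: "real \<Rightarrow> real^'n \<Rightarrow> real^'n \<Rightarrow> real^'n \<Rightarrow> real"
  assumes L: "smooth_lagrangian L" "T_lagrangian L"
begin

lemmas momentum_indep = q_independent[OF smooth_momentum[OF L(1)] momentum_q_deriv[OF L]]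

lemma charge_q_deriv': "x \<in> phase_dom \<Longrightarrow> deriv_on phase_dom (charge L) x (0, 0, 0, w) = 0"
  using charge_q_deriv[OF L] by (cases x) blast

lemmas charge_indep = q_independent[OF smooth_charge[OF L(1)] charge_q_deriv']

text \<open>The t-derivative is the momentum at q + t p, which equals the momentum at q = 0. In the
  local coordinates, adding t p shifts xi by t and leaves eta unchanged.\<close>

lemma lag_affine:
  assumes x: "(s, u, p, q) \<in> phase_dom"
  shows "lag L (s, u, p, q + t *\<^sub>R p) = lag L (s, u, p, q) + t * momentum L (s, u, p, 0)"
proof -
  have "lag L (s, u, p, q + t *\<^sub>R p) - t * momentum L (s, u, p, 0)
      = lag L (s, u, p, q + 0 *\<^sub>R p) - 0 * momentum L (s, u, p, 0)"
  proof (rule has_derivative_zero_unique[of UNIV "\<lambda>t. lag L (s, u, p, q + t *\<^sub>R p) - t * momentum L (s, u, p, 0)"])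
    fix t :: real
    have x': "(s, u, p, q + t *\<^sub>R p) \<in> phase_dom" using x by auto
    have "((\<lambda>t. lag L (s, u, p, q + t *\<^sub>R p)) has_derivative
        (\<lambda>h. deriv_on phase_dom (lag L) (s, u, p, q + t *\<^sub>R p) (0, 0, 0, h *\<^sub>R p))) (at t within UNIV)"
      by (rule has_derivative_chain[where f = "\<lambda>t. (s, u, p, q + t *\<^sub>R p)",
            OF smooth_on_has_derivative[OF smooth_lag[OF L(1)] x']])
        (use x in \<open>auto intro!: derivative_eq_intros simp: zero_prod_def\<close>)
    moreover have "deriv_on phase_dom (lag L) (s, u, p, q + t *\<^sub>R p) (0, 0, 0, h *\<^sub>R p)
        = h * momentum L (s, u, p, 0)" for h
      using linear_cmul[OF smooth_on_deriv_linear[OF smooth_lag[OF L(1)] x'], of h "(0, 0, 0, p)"]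
        momentum_indep(1)[OF _ x'] by (simp add: momentum_def[of L "(s, u, p, q + t *\<^sub>R p)"])
    ultimately have "((\<lambda>t. lag L (s, u, p, q + t *\<^sub>R p)) has_derivative
        (\<lambda>h. h * momentum L (s, u, p, 0))) (at t)" by simp
    then show "((\<lambda>t. lag L (s, u, p, q + t *\<^sub>R p) - t * momentum L (s, u, p, 0)) has_derivative (\<lambda>h. 0))
        (at t within UNIV)"
      by (auto intro!: derivative_eq_intros)
  qed auto
  then show ?thesis by simp
qed

text \<open>This is A = B' - C solved for the derivative of L along the scaling direction (p, 2q).
  It will control L along rays on which zeta = eta / r is constant.\<close>

lemma lag_scaling_deriv:
  assumes x: "(s, u, p, q) \<in> phase_dom"
  shows "deriv_on phase_dom (lag L) (s, u, p, q) (0, 0, p, 2 *\<^sub>R q)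
    = lag L (s, u, p, q) + deriv_on phase_dom (momentum L) (s, u, p, 0) (1, p, q, 0) - charge L (s, u, p, 0)"
  using momentum_indep(2)[OF _ x, of 1 p q 0] charge_indep(1)[OF _ x]
  by (simp add: charge_def[of L "(s, u, p, q)"] energy_def)

lemma lag_s_deriv:
  assumes x: "(s, u, p, q) \<in> phase_dom"
  shows "deriv_on phase_dom (lag L) (s, u, p, q) (1, 0, 0, 0)
    = deriv_on phase_dom (charge L) (s, u, p, 0) (1, p, q, 0)"
  using charge_transport[OF L x] charge_indep(2)[OF _ x, of 1 p q 0] by simp

text \<open>The two values q = p and q = 0 are compared in \<open>lag_s_deriv\<close>: the charge
  side changes by C_p.p, and by \<open>lag_affine\<close> with t = 1 the lag side changes by
  B_s.\<close>

lemma charge_momentum_closed: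
  assumes x: "(s, u, p, 0) \<in> phase_dom"
  shows "deriv_on phase_dom (charge L) (s, u, p, 0) (0, 0, p, 0)
    = deriv_on phase_dom (momentum L) (s, u, p, 0) (1, 0, 0, 0)"
proof -
  have xp: "(s, u, p, p) \<in> phase_dom" and s: "s \<in> {0..1}" using x by auto
  have d: "((\<lambda>s. g (s, u, p, q)) has_derivative (\<lambda>h. deriv_on phase_dom g (s, u, p, q) (h, 0, 0, 0)))
      (at s within {0..1})" if "smooth_on phase_dom g" "(s, u, p, q) \<in> phase_dom"
    for g :: "_ \<Rightarrow> real" and q
    by (rule has_derivative_chain[where f = "\<lambda>s. (s, u, p, q)", OF smooth_on_has_derivative[OF that]])
      (use that(2) in \<open>auto intro!: derivative_eq_intros simp: zero_prod_def\<close>)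
  have eq: "lag L (t, u, p, p) = lag L (t, u, p, 0) + momentum L (t, u, p, 0)" if "t \<in> {0..1}" for t
    using lag_affine[of t u p 0 1] that x by simp
  have "((\<lambda>t. lag L (t, u, p, p)) has_derivative
      (\<lambda>h. deriv_on phase_dom (lag L) (s, u, p, 0) (h, 0, 0, 0)
        + deriv_on phase_dom (momentum L) (s, u, p, 0) (h, 0, 0, 0))) (at s within {0..1})"
    by (rule has_derivative_transform[OF s eq])
      (auto intro!: has_derivative_add d smooth_lag smooth_momentum L x)
  from coord_dense_unique[OF coord_dense_01 s d[OF smooth_lag[OF L(1)] xp] this]
  have "deriv_on phase_dom (lag L) (s, u, p, p) (1, 0, 0, 0)
      = deriv_on phase_dom (lag L) (s, u, p, 0) (1, 0, 0, 0)
        + deriv_on phase_dom (momentum L) (s, u, p, 0) (1, 0, 0, 0)" by meson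
  then show ?thesis
    using lag_s_deriv[OF x] lag_s_deriv[OF xp]
      linear_add[OF smooth_on_deriv_linear[OF smooth_charge[OF L(1)] x], of "(1, p, 0, 0)" "(0, 0, p, 0)"]
    by simp
qed

end

section \<open>Polar coordinates\<close>

abbreviation polar_dom :: "(real \<times> 'u::euclidean_space \<times> real \<times> 'e::euclidean_space) set" where
  "polar_dom \<equiv> {0..1} \<times> UNIV \<times> {0<..} \<times> UNIV"

lemma coord_dense_polar_dom: "coord_dense polar_dom"
  by (intro coord_dense_Times coord_dense_01 coord_dense_open) auto

lemma convex_polar_dom: "convex polar_dom"
  by (intro convex_Times) auto

text \<open>The primitive of the closed form \<open>c ds + b dr\<close>, integrated along the segment from \<open>(s\<^sub>0, r\<^sub>0)\<close> to \<open>(s, r)\<close>.\<close>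

definition primitive ::
  "real \<Rightarrow> real \<Rightarrow> (real \<times> 'u \<times> real \<times> 'e \<Rightarrow> real) \<Rightarrow> (real \<times> 'u \<times> real \<times> 'e \<Rightarrow> real) \<Rightarrow>
    real \<times> 'u \<times> real \<times> 'e \<Rightarrow> real" where
  "primitive s0 r0 c b = (\<lambda>(s, u, r, \<theta>). integral {0..1} (\<lambda>t.
     (s - s0) * c (s0 + t * (s - s0), u, r0 + t * (r - r0), \<theta>)
   + (r - r0) * b (s0 + t * (s - s0), u, r0 + t * (r - r0), \<theta>)))"

lemma segment_01: "0 \<le> t \<Longrightarrow> t \<le> 1 \<Longrightarrow> a \<in> {0..1} \<Longrightarrow> b \<in> {0..1} \<Longrightarrow> a + t * (b - a) \<in> {0..1::real}"
  using convexD_alt[of "{0..1::real}" a b t] by (simp add: algebra_simps)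

lemma segment_pos: "0 \<le> t \<Longrightarrow> t \<le> 1 \<Longrightarrow> 0 < a \<Longrightarrow> 0 < b \<Longrightarrow> 0 < a + t * (b - a :: real)"
  using convexD_alt[of "{0::real<..}" a b t] by (simp add: algebra_simps)

context
  fixes c b :: "real \<times> 'u::euclidean_space \<times> real \<times> 'e::euclidean_space \<Rightarrow> real" and s0 r0 :: real
  assumes c: "smooth_on polar_dom c" and b: "smooth_on polar_dom b"
    and s0: "s0 \<in> {0..1}" and r0: "r0 > 0"
begin

lemma smooth_primitive_integrand:
  "smooth_on (polar_dom \<times> {0..1}) (\<lambda>((s, u, r, \<theta>), t).
     (s - s0) * c (s0 + t * (s - s0), u, r0 + t * (r - r0), \<theta>)
   + (r - r0) * b (s0 + t * (s - s0), u, r0 + t * (r - r0), \<theta>))"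
proof -
  let ?l = "\<lambda>y :: (real \<times> 'u \<times> real \<times> 'e) \<times> real.
    (s0 + snd y * (fst (fst y) - s0), fst (snd (fst y)),
     r0 + snd y * (fst (snd (snd (fst y))) - r0), snd (snd (snd (fst y))))"
  have "?l ` (polar_dom \<times> {0..1}) \<subseteq> polar_dom"
    using s0 r0 segment_01[OF _ _ s0] segment_pos[OF _ _ r0] by auto
  moreover have "smooth_on (polar_dom \<times> {0..1}) ?l"
    by (intro smooth_on_Pair smooth_on_add smooth_on_mult smooth_on_diff smooth_on_const
        smooth_on_fst smooth_on_snd smooth_on_ident)
  ultimately have "smooth_on (polar_dom \<times> {0..1}) (\<lambda>y. (fst (fst y) - s0) * c (?l y)
      + (fst (snd (snd (fst y))) - r0) * b (?l y))"
    by (intro smooth_on_add smooth_on_mult smooth_on_diff smooth_on_const smooth_on_fst smooth_on_snd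
        smooth_on_ident smooth_on_compose[OF c] smooth_on_compose[OF b])
  then show ?thesis by (simp add: case_prod_unfold)
qed

lemma smooth_primitive: "smooth_on polar_dom (primitive s0 r0 c b)"
  using smooth_on_integral[OF convex_polar_dom smooth_primitive_integrand]
  by (simp add: primitive_def case_prod_unfold)

text \<open>Differentiation under the integral, for arbitrary smooth coefficients. It is kept as an
  integral in all directions: closedness simplifies the s- and r-directions, while the directions of
  u and theta are used in this raw form.\<close>

lemma primitive_has_derivative:
  assumes z: "(s, u, r, \<theta>) \<in> polar_dom"
  defines "l \<equiv> \<lambda>t. (s0 + t * (s - s0), u, r0 + t * (r - r0), \<theta>)"
  shows "deriv_on polar_dom (primitive s0 r0 c b) (s, u, r, \<theta>) (vs, vu, vr, v\<theta>) = integral {0..1} (\<lambda>t.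
     vs * c (l t) + (s - s0) * deriv_on polar_dom c (l t) (t * vs, vu, t * vr, v\<theta>)
   + (vr * b (l t) + (r - r0) * deriv_on polar_dom b (l t) (t * vs, vu, t * vr, v\<theta>)))"
proof -
  let ?e = "\<lambda>t (vs, vu, vr, v\<theta>).
     vs * c (l t) + (s - s0) * deriv_on polar_dom c (l t) (t * vs, vu, t * vr, v\<theta>)
   + (vr * b (l t) + (r - r0) * deriv_on polar_dom b (l t) (t * vs, vu, t * vr, v\<theta>))"
  let ?g = "\<lambda>((s, u, r, \<theta>), t).
     (s - s0) * c (s0 + t * (s - s0), u, r0 + t * (r - r0), \<theta>)
   + (r - r0) * b (s0 + t * (s - s0), u, r0 + t * (r - r0), \<theta>)"
  have "((\<lambda>z. integral {0..1} (\<lambda>t. ?g (z, t))) has_derivative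
      (\<lambda>v. integral {0..1} (\<lambda>t. ?e t v))) (at (s, u, r, \<theta>) within polar_dom)"
  proof (rule smooth_on_integral_has_derivative[OF convex_polar_dom coord_dense_polar_dom
        smooth_primitive_integrand _ z])
    fix t :: real assume t: "t \<in> {0..1}"
    let ?l = "\<lambda>z :: real \<times> 'u \<times> real \<times> 'e. (s0 + t * (fst z - s0), fst (snd z),
      r0 + t * (fst (snd (snd z)) - r0), snd (snd (snd z)))"
    have l_eq: "?l (s, u, r, \<theta>) = l t" by (simp add: l_def)
    have l_in: "?l ` polar_dom \<subseteq> polar_dom"
      using t s0 r0 segment_01[OF _ _ s0] segment_pos[OF _ _ r0] by auto
    have "?l (s, u, r, \<theta>) \<in> polar_dom" by (rule subsetD[OF l_in imageI[OF z]])
    then have lt: "l t \<in> polar_dom" by (simp only: l_eq)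
    have dl: "(?l has_derivative (\<lambda>v. (t * fst v, fst (snd v), t * fst (snd (snd v)), snd (snd (snd v)))))
        (at (s, u, r, \<theta>) within polar_dom)"
      by (auto intro!: derivative_eq_intros)
    have dc: "((\<lambda>z. g (?l z)) has_derivative (\<lambda>v. deriv_on polar_dom g (l t)
        (t * fst v, fst (snd v), t * fst (snd (snd v)), snd (snd (snd v)))))
        (at (s, u, r, \<theta>) within polar_dom)" if "smooth_on polar_dom g" for g :: "_ \<Rightarrow> real"
    proof (rule has_derivative_chain[OF _ dl l_in])
      show "(g has_derivative deriv_on polar_dom g (l t)) (at (?l (s, u, r, \<theta>)) within polar_dom)"
        unfolding l_eq by (rule smooth_on_has_derivative[OF that lt])
    qed
    have ds: "((\<lambda>z. fst z - s0) has_derivative (\<lambda>v. fst v)) (at (s, u, r, \<theta>) within polar_dom)"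
      and dr: "((\<lambda>z. fst (snd (snd z)) - r0) has_derivative (\<lambda>v. fst (snd (snd v)))) (at (s, u, r, \<theta>) within polar_dom)"
      by (auto intro!: derivative_eq_intros)
    have "((\<lambda>z. (fst z - s0) * c (?l z) + (fst (snd (snd z)) - r0) * b (?l z)) has_derivative
        (\<lambda>v. ?e t v)) (at (s, u, r, \<theta>) within polar_dom)"
      by (rule has_derivative_eq_rhs[OF has_derivative_add[OF has_derivative_mult[OF ds dc[OF c]]
            has_derivative_mult[OF dr dc[OF b]]]])
        (auto simp: fun_eq_iff l_def)
    then show "((\<lambda>z. ?g (z, t)) has_derivative ?e t) (at (s, u, r, \<theta>) within polar_dom)"
      by (simp add: case_prod_unfold)
  qed
  then have "(primitive s0 r0 c b has_derivative (\<lambda>v. integral {0..1} (\<lambda>t. ?e t v)))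
      (at (s, u, r, \<theta>) within polar_dom)"
    by (simp add: primitive_def case_prod_unfold)
  from coord_dense_unique[OF coord_dense_polar_dom z smooth_on_has_derivative[OF smooth_primitive z] this]
  show ?thesis by simp
qed

text \<open>The Poincare lemma on the (s, r)-strip, with u and theta as parameters. In the
  s-direction the integrand is c + t ((s - s0) c_s + (r - r0) b_s); closedness replaces b_s by c_r,
  which makes it the t-derivative of t c(l(t)). The r-direction is symmetric.\<close>

lemma primitive_closed:
  assumes closed: "\<And>z. z \<in> polar_dom \<Longrightarrow> deriv_on polar_dom c z (0, 0, 1, 0) = deriv_on polar_dom b z (1, 0, 0, 0)"
    and z: "(s, u, r, \<theta>) \<in> polar_dom"
  shows "deriv_on polar_dom (primitive s0 r0 c b) (s, u, r, \<theta>) (1, 0, 0, 0) = c (s, u, r, \<theta>)"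
    and "deriv_on polar_dom (primitive s0 r0 c b) (s, u, r, \<theta>) (0, 0, 1, 0) = b (s, u, r, \<theta>)"
proof -
  define l where "l t = (s0 + t * (s - s0), u, r0 + t * (r - r0), \<theta>)" for t
  have l: "l t \<in> polar_dom" if "t \<in> {0..1}" for t
    using that z segment_01[OF _ _ s0] segment_pos[OF _ _ r0] by (auto simp: l_def)
  have dl: "(l has_vector_derivative (s - s0, 0, r - r0, 0)) (at t within {0..1})" for t
    unfolding l_def[abs_def]
    by (intro has_vector_derivative_Pair) (auto intro!: derivative_eq_intros
        simp flip: has_real_derivative_iff_has_vector_derivative)
  \<comment> \<open>The antiderivative is t g(l(t)), which vanishes at t = 0.\<close>
  have prim: "((\<lambda>t. g (l t) + t * deriv_on polar_dom g (l t) (s - s0, 0, r - r0, 0)) has_integral g (l 1)) {0..1}"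
    if g: "smooth_on polar_dom g" for g :: "_ \<Rightarrow> real"
  proof -
    have "((\<lambda>t. t * g (l t)) has_real_derivative
        g (l t) + t * deriv_on polar_dom g (l t) (s - s0, 0, r - r0, 0)) (at t within {0..1})"
      if t: "t \<in> {0..1}" for t
    proof -
      have "((\<lambda>t. g (l t)) has_real_derivative deriv_on polar_dom g (l t) (s - s0, 0, r - r0, 0)) (at t within {0..1})"
        unfolding has_real_derivative_iff_has_vector_derivative
        by (rule smooth_on_chain_vector[OF g dl _ t]) (use l in blast)
      from DERIV_mult[OF DERIV_ident this] show ?thesis by (simp add: algebra_simps)
    qed
    then have "((\<lambda>t. g (l t) + t * deriv_on polar_dom g (l t) (s - s0, 0, r - r0, 0)) has_integral
        1 * g (l 1) - 0 * g (l 0)) {0..1}"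
      by (intro fundamental_theorem_of_calculus) (auto simp: has_real_derivative_iff_has_vector_derivative)
    then show ?thesis by simp
  qed
  have l1: "l 1 = (s, u, r, \<theta>)" by (simp add: l_def)
  have split: "deriv_on polar_dom g (l t) (s - s0, 0, r - r0, 0)
      = (s - s0) * deriv_on polar_dom g (l t) (1, 0, 0, 0) + (r - r0) * deriv_on polar_dom g (l t) (0, 0, 1, 0)"
    and scale: "deriv_on polar_dom g (l t) (t, 0, 0, 0) = t * deriv_on polar_dom g (l t) (1, 0, 0, 0)"
      "deriv_on polar_dom g (l t) (0, 0, t, 0) = t * deriv_on polar_dom g (l t) (0, 0, 1, 0)"
    if g: "smooth_on polar_dom g" and t: "t \<in> {0..1}" for g :: "_ \<Rightarrow> real" and t
  proof -
    note lin = smooth_on_deriv_linear[OF g l[OF t]]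
    have eq: "(s - s0, 0, r - r0, 0) = (s - s0) *\<^sub>R (1, 0 :: 'u, 0, 0 :: 'e) + (r - r0) *\<^sub>R (0, 0, 1, 0)" by simp
    show "deriv_on polar_dom g (l t) (s - s0, 0, r - r0, 0)
      = (s - s0) * deriv_on polar_dom g (l t) (1, 0, 0, 0) + (r - r0) * deriv_on polar_dom g (l t) (0, 0, 1, 0)"
      unfolding eq linear_add[OF lin] linear_cmul[OF lin] by simp
    show "deriv_on polar_dom g (l t) (t, 0, 0, 0) = t * deriv_on polar_dom g (l t) (1, 0, 0, 0)"
      "deriv_on polar_dom g (l t) (0, 0, t, 0) = t * deriv_on polar_dom g (l t) (0, 0, 1, 0)"
      using linear_cmul[OF lin, of t "(1, 0, 0, 0)"] linear_cmul[OF lin, of t "(0, 0, 1, 0)"] by simp_all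
  qed
  have "deriv_on polar_dom (primitive s0 r0 c b) (s, u, r, \<theta>) (1, 0, 0, 0) = integral {0..1} (\<lambda>t.
      1 * c (l t) + (s - s0) * deriv_on polar_dom c (l t) (t * 1, 0, t * 0, 0)
    + (0 * b (l t) + (r - r0) * deriv_on polar_dom b (l t) (t * 1, 0, t * 0, 0)))"
    unfolding l_def by (rule primitive_has_derivative[OF z, of 1 0 0 0])
  also have "\<dots> = c (l 1)"
    by (rule integral_unique, rule has_integral_eq[OF _ prim[OF c]])
      (simp add: split[OF c] scale[OF c] scale[OF b] closed[OF l] algebra_simps)
  finally show "deriv_on polar_dom (primitive s0 r0 c b) (s, u, r, \<theta>) (1, 0, 0, 0) = c (s, u, r, \<theta>)"
    unfolding l1 .
  have "deriv_on polar_dom (primitive s0 r0 c b) (s, u, r, \<theta>) (0, 0, 1, 0) = integral {0..1} (\<lambda>t.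
      0 * c (l t) + (s - s0) * deriv_on polar_dom c (l t) (t * 0, 0, t * 1, 0)
    + (1 * b (l t) + (r - r0) * deriv_on polar_dom b (l t) (t * 0, 0, t * 1, 0)))"
    unfolding l_def by (rule primitive_has_derivative[OF z, of 0 0 1 0])
  also have "\<dots> = b (l 1)"
    by (rule integral_unique, rule has_integral_eq[OF _ prim[OF b]])
      (simp add: split[OF b] scale[OF c] scale[OF b] closed[OF l] algebra_simps)
  finally show "deriv_on polar_dom (primitive s0 r0 c b) (s, u, r, \<theta>) (0, 0, 1, 0) = b (s, u, r, \<theta>)"
    unfolding l1 .
qed

end

section \<open>The closed form and the representation in polar coordinates\<close>

definition polar_charge :: "(real \<Rightarrow> real^'n \<Rightarrow> real^'n \<Rightarrow> real^'n \<Rightarrow> real) \<Rightarrow>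
    ('e \<Rightarrow> real^'n) \<Rightarrow> real \<times> (real^'n) \<times> real \<times> 'e \<Rightarrow> real" where
  "polar_charge L e = (\<lambda>(s, u, r, \<theta>). charge L (s, u, r *\<^sub>R e \<theta>, 0))"

text \<open>The coefficient of xi is B in L and r Xi_r in the total derivative of Xi; hence the
  division by r.\<close>

definition polar_momentum :: "(real \<Rightarrow> real^'n \<Rightarrow> real^'n \<Rightarrow> real^'n \<Rightarrow> real) \<Rightarrow>
    ('e \<Rightarrow> real^'n) \<Rightarrow> real \<times> (real^'n) \<times> real \<times> 'e \<Rightarrow> real" where
  "polar_momentum L e = (\<lambda>(s, u, r, \<theta>). momentum L (s, u, r *\<^sub>R e \<theta>, 0) * inverse r)"

context
  fixes L :: "real \<Rightarrow> real^'n \<Rightarrow> real^'n \<Rightarrow> real^'n \<Rightarrow> real"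
    and e :: "'e::euclidean_space \<Rightarrow> real^'n"
  assumes L: "smooth_lagrangian L" "T_lagrangian L"
    and e: "smooth_on UNIV e" and e_nz: "\<And>\<theta>. e \<theta> \<noteq> 0"
begin

lemma smooth_on_e: "smooth_on S f \<Longrightarrow> smooth_on S (\<lambda>x. e (f x))"
  using smooth_on_compose[OF e] by blast

lemma smooth_polar_lift:
  fixes g :: "real \<times> (real^'n) \<times> (real^'n) \<times> (real^'n) \<Rightarrow> real"
  assumes "smooth_on phase_dom g"
  shows "smooth_on polar_dom (\<lambda>z. g (fst z, fst (snd z), fst (snd (snd z)) *\<^sub>R e (snd (snd (snd z))), 0))"
  by (rule smooth_on_compose[OF assms])
    (use e_nz in \<open>auto intro!: smooth_on_Pair smooth_on_const smooth_on_scaleR smooth_on_fst smooth_on_snd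
      smooth_on_ident smooth_on_e\<close>)

lemma polar_lift_has_derivative:
  fixes g :: "real \<times> (real^'n) \<times> (real^'n) \<times> (real^'n) \<Rightarrow> real"
  assumes g: "smooth_on phase_dom g" and z: "(s, u, r, \<theta>) \<in> polar_dom"
  shows "((\<lambda>z. g (fst z, fst (snd z), fst (snd (snd z)) *\<^sub>R e (snd (snd (snd z))), 0)) has_derivative
    (\<lambda>(vs, vu, vr, v\<theta>). deriv_on phase_dom g (s, u, r *\<^sub>R e \<theta>, 0)
      (vs, vu, vr *\<^sub>R e \<theta> + r *\<^sub>R deriv_on UNIV e \<theta> v\<theta>, 0))) (at (s, u, r, \<theta>) within polar_dom)"
proof -
  let ?P = "\<lambda>z :: real \<times> (real^'n) \<times> real \<times> 'e.
    (fst z, fst (snd z), fst (snd (snd z)) *\<^sub>R e (snd (snd (snd z))), 0 :: real^'n)"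
  have P: "?P ` polar_dom \<subseteq> phase_dom" using e_nz by auto
  have de: "((\<lambda>z. e (snd (snd (snd z)))) has_derivative (\<lambda>v. deriv_on UNIV e \<theta> (snd (snd (snd v)))))
      (at (s, u, r, \<theta>) within polar_dom)"
    by (rule has_derivative_chain[where f = "\<lambda>z. snd (snd (snd z))" and T = UNIV])
      (use smooth_on_has_derivative[OF e, of \<theta>] in \<open>auto intro!: derivative_eq_intros\<close>)
  have "(?P has_derivative (\<lambda>v. (fst v, fst (snd v),
      r *\<^sub>R deriv_on UNIV e \<theta> (snd (snd (snd v))) + fst (snd (snd v)) *\<^sub>R e \<theta>, 0)))
      (at (s, u, r, \<theta>) within polar_dom)"
    by (auto intro!: derivative_eq_intros has_derivative_eq_rhs[OF has_derivative_scaleR[OF _ de]])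
  from has_derivative_chain[OF _ this P, of g "deriv_on phase_dom g (s, u, r *\<^sub>R e \<theta>, 0)"]
  have "((\<lambda>z. g (?P z)) has_derivative (\<lambda>v. deriv_on phase_dom g (s, u, r *\<^sub>R e \<theta>, 0) (fst v, fst (snd v),
      r *\<^sub>R deriv_on UNIV e \<theta> (snd (snd (snd v))) + fst (snd (snd v)) *\<^sub>R e \<theta>, 0)))
      (at (s, u, r, \<theta>) within polar_dom)"
    using smooth_on_has_derivative[OF g, of "(s, u, r *\<^sub>R e \<theta>, 0)"] z e_nz by auto
  then show ?thesis by (simp add: case_prod_unfold add.commute)
qed

lemma smooth_polar_charge: "smooth_on polar_dom (polar_charge L e)"
  using smooth_polar_lift[OF smooth_charge[OF L(1)]] by (simp add: polar_charge_def case_prod_unfold)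

lemma smooth_polar_momentum: "smooth_on polar_dom (polar_momentum L e)"
proof -
  have "smooth_on polar_dom (\<lambda>z :: real \<times> (real^'n) \<times> real \<times> 'e. inverse (fst (snd (snd z))))"
    by (intro smooth_on_inverse smooth_on_fst smooth_on_snd smooth_on_ident) auto
  from smooth_on_mult[OF smooth_polar_lift[OF smooth_momentum[OF L(1)]] this]
  show ?thesis by (simp add: polar_momentum_def case_prod_unfold)
qed

lemma polar_charge_deriv:
  assumes z: "(s, u, r, \<theta>) \<in> polar_dom"
  shows "deriv_on polar_dom (polar_charge L e) (s, u, r, \<theta>) (vs, vu, vr, v\<theta>)
    = deriv_on phase_dom (charge L) (s, u, r *\<^sub>R e \<theta>, 0) (vs, vu, vr *\<^sub>R e \<theta> + r *\<^sub>R deriv_on UNIV e \<theta> v\<theta>, 0)"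
  using coord_dense_unique[OF coord_dense_polar_dom z smooth_on_has_derivative[OF smooth_polar_charge z]]
    polar_lift_has_derivative[OF smooth_charge[OF L(1)] z]
  by (simp add: polar_charge_def case_prod_unfold)

text \<open>Restricted to directions with r-component 0, in which the factor 1/r is
  constant.\<close>

lemma polar_momentum_deriv:
  assumes z: "(s, u, r, \<theta>) \<in> polar_dom"
  shows "deriv_on polar_dom (polar_momentum L e) (s, u, r, \<theta>) (vs, vu, 0, v\<theta>)
    = deriv_on phase_dom (momentum L) (s, u, r *\<^sub>R e \<theta>, 0) (vs, vu, r *\<^sub>R deriv_on UNIV e \<theta> v\<theta>, 0) * inverse r"
proof -
  have "((\<lambda>z :: real \<times> (real^'n) \<times> real \<times> 'e. inverse (fst (snd (snd z)))) has_derivative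
      (\<lambda>v. - (inverse r * fst (snd (snd v)) * inverse r))) (at (s, u, r, \<theta>) within polar_dom)"
    using z by (auto intro!: derivative_eq_intros)
  from has_derivative_mult[OF polar_lift_has_derivative[OF smooth_momentum[OF L(1)] z] this]
  have "(polar_momentum L e has_derivative
     (\<lambda>v. momentum L (s, u, r *\<^sub>R e \<theta>, 0) * - (inverse r * fst (snd (snd v)) * inverse r)
       + (case v of (vs, vu, vr, v\<theta>) \<Rightarrow> deriv_on phase_dom (momentum L) (s, u, r *\<^sub>R e \<theta>, 0)
      (vs, vu, vr *\<^sub>R e \<theta> + r *\<^sub>R deriv_on UNIV e \<theta> v\<theta>, 0)) * inverse r)) (at (s, u, r, \<theta>) within polar_dom)"
    by (simp add: polar_momentum_def case_prod_unfold)
  from coord_dense_unique[OF coord_dense_polar_dom z smooth_on_has_derivative[OF smooth_polar_momentum z] this]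
  show ?thesis by simp
qed

text \<open>The r-direction moves p along e = p / r, so this is
  \<open>charge_momentum_closed\<close> divided by r.\<close>

lemma polar_closed:
  assumes "z \<in> polar_dom"
  shows "deriv_on polar_dom (polar_charge L e) z (0, 0, 1, 0) = deriv_on polar_dom (polar_momentum L e) z (1, 0, 0, 0)"
proof -
  obtain s u r \<theta> where z_eq: "z = (s, u, r, \<theta>)" by (cases z)
  with assms have z: "(s, u, r, \<theta>) \<in> polar_dom" by simp
  have x: "(s, u, r *\<^sub>R e \<theta>, 0) \<in> phase_dom" and r: "r > 0" using z e_nz by auto
  have e'0: "deriv_on UNIV e \<theta> 0 = 0"
    by (rule linear_0[OF smooth_on_deriv_linear[OF e]]) simp
  have "deriv_on phase_dom (charge L) (s, u, r *\<^sub>R e \<theta>, 0) (r *\<^sub>R (0, 0, e \<theta>, 0))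
      = r * deriv_on phase_dom (charge L) (s, u, r *\<^sub>R e \<theta>, 0) (0, 0, e \<theta>, 0)"
    using linear_cmul[OF smooth_on_deriv_linear[OF smooth_charge[OF L(1)] x], of r "(0, 0, e \<theta>, 0)"] by simp
  with charge_momentum_closed[OF L x] r show ?thesis
    unfolding z_eq polar_charge_deriv[OF z] polar_momentum_deriv[OF z] e'0
    by (simp add: field_simps)
qed

text \<open>The function f: the value of (L - C) / r at s = s0, r = r0, xi = 0 and eta = r0 zeta. In
  these coordinates q = r e_theta[eta] = r^2 e_theta[zeta], which explains the square.\<close>

definition polar_rest :: "real \<Rightarrow> real \<Rightarrow> real^'n \<Rightarrow> 'e \<Rightarrow> 'e \<Rightarrow> real" where
  "polar_rest s0 r0 u \<theta> \<zeta> =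
    (lag L (s0, u, r0 *\<^sub>R e \<theta>, r0\<^sup>2 *\<^sub>R deriv_on UNIV e \<theta> \<zeta>) - polar_charge L e (s0, u, r0, \<theta>)) * inverse r0"

lemma smooth_polar_rest:
  assumes "s0 \<in> {0..1}" "r0 > 0"
  shows "smooth_on UNIV (\<lambda>(u, \<theta>, \<zeta>). polar_rest s0 r0 u \<theta> \<zeta>)"
proof -
  have "smooth_on UNIV (\<lambda>y :: (real^'n) \<times> 'e \<times> 'e.
      lag L (s0, fst y, r0 *\<^sub>R e (fst (snd y)), r0\<^sup>2 *\<^sub>R deriv_on UNIV e (fst (snd y)) (snd (snd y))))"
    by (rule smooth_on_compose[OF smooth_lag[OF L(1)]])
      (use assms e_nz in \<open>auto intro!: smooth_on_Pair smooth_on_const smooth_on_scaleR smooth_on_fst smooth_on_snd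
        smooth_on_ident smooth_on_e smooth_on_deriv_on[OF coord_dense_open[OF open_UNIV] e]\<close>)
  moreover have "smooth_on UNIV (\<lambda>y :: (real^'n) \<times> 'e \<times> 'e. polar_charge L e (s0, fst y, r0, fst (snd y)))"
    by (rule smooth_on_compose[OF smooth_polar_charge])
      (use assms in \<open>auto intro!: smooth_on_Pair smooth_on_const smooth_on_fst smooth_on_snd smooth_on_ident\<close>)
  ultimately show ?thesis
    unfolding polar_rest_def case_prod_unfold
    by (intro smooth_on_mult smooth_on_diff smooth_on_const)
qed

text \<open>
  Along the segment, with \<open>\<zeta> = \<eta> / r\<close> kept fixed, the derivative of \<open>(L - c) / r\<close> is the integrand
  of the derivative of the primitive in the direction \<open>(0, e, 0, \<zeta>)\<close>.
\<close>

lemma polar_segment: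
  assumes s0: "s0 \<in> {0..1}" and r0: "r0 > 0" and z: "(s, u, r, \<theta>) \<in> polar_dom"
  shows "(lag L (s, u, r *\<^sub>R e \<theta>, r\<^sup>2 *\<^sub>R deriv_on UNIV e \<theta> \<zeta>) - polar_charge L e (s, u, r, \<theta>)) * inverse r
      - polar_rest s0 r0 u \<theta> \<zeta>
    = deriv_on polar_dom (primitive s0 r0 (polar_charge L e) (polar_momentum L e)) (s, u, r, \<theta>) (0, e \<theta>, 0, \<zeta>)"
proof -
  define \<sigma> where "\<sigma> t = s0 + t * (s - s0)" for t
  define \<rho> where "\<rho> t = r0 + t * (r - r0)" for t
  define w where "w = deriv_on UNIV e \<theta> \<zeta>"
  define N where "N t = lag L (\<sigma> t, u, \<rho> t *\<^sub>R e \<theta>, (\<rho> t)\<^sup>2 *\<^sub>R w) - polar_charge L e (\<sigma> t, u, \<rho> t, \<theta>)" for t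
  define I where "I t = (s - s0) * deriv_on polar_dom (polar_charge L e) (\<sigma> t, u, \<rho> t, \<theta>) (0, e \<theta>, 0, \<zeta>)
     + (r - r0) * deriv_on polar_dom (polar_momentum L e) (\<sigma> t, u, \<rho> t, \<theta>) (0, e \<theta>, 0, \<zeta>)" for t
  have \<sigma>: "\<sigma> t \<in> {0..1}" and \<rho>: "\<rho> t > 0" if "t \<in> {0..1}" for t
    using that z segment_01[OF _ _ s0] segment_pos[OF _ _ r0] by (auto simp: \<sigma>_def \<rho>_def)
  have d\<sigma>: "(\<sigma> has_real_derivative s - s0) (at t within {0..1})"
    and d\<rho>: "(\<rho> has_real_derivative r - r0) (at t within {0..1})" for t
    unfolding \<sigma>_def[abs_def] \<rho>_def[abs_def] by (auto intro!: derivative_eq_intros)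
  have e'0: "deriv_on UNIV e \<theta> 0 = 0"
    by (rule linear_0[OF smooth_on_deriv_linear[OF e]]) simp
  have dN: "((\<lambda>t. N t / \<rho> t) has_real_derivative I t) (at t within {0..1})" if t: "t \<in> {0..1}" for t
  proof -
    let ?p = "\<rho> t *\<^sub>R e \<theta>" and ?q = "(\<rho> t)\<^sup>2 *\<^sub>R w"
    let ?x = "(\<sigma> t, u, ?p, ?q)" and ?xo = "(\<sigma> t, u, ?p, 0 :: real^'n)"
    have x: "?x \<in> phase_dom" and x0: "?xo \<in> phase_dom" and y: "(\<sigma> t, u, \<rho> t, \<theta>) \<in> polar_dom"
      using \<sigma>[OF t] \<rho>[OF t] e_nz by auto
    let ?F' = "deriv_on phase_dom (lag L) ?x" and ?C' = "deriv_on phase_dom (charge L) ?xo"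
      and ?B' = "deriv_on phase_dom (momentum L) ?xo"
    note linF = smooth_on_deriv_linear[OF smooth_lag[OF L(1)] x]
      and linC = smooth_on_deriv_linear[OF smooth_charge[OF L(1)] x0]
      and linB = smooth_on_deriv_linear[OF smooth_momentum[OF L(1)] x0]
    have scal: "((\<lambda>t. g t *\<^sub>R v) has_vector_derivative g' *\<^sub>R v) (at t within {0..1})"
      if "(g has_real_derivative g') (at t within {0..1})" for g g' and v :: "real^'n"
      using has_vector_derivative_scaleR[OF that has_vector_derivative_const[of v]] by simp
    have "((\<lambda>t. (\<rho> t)\<^sup>2) has_real_derivative 2 * \<rho> t * (r - r0)) (at t within {0..1})"
      using DERIV_power[OF d\<rho>, of 2] by (simp add: mult_ac)
    note dphase = has_vector_derivative_Pair[OF d\<sigma>[unfolded has_real_derivative_iff_has_vector_derivative]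
      has_vector_derivative_Pair[OF has_vector_derivative_const[of u]
        has_vector_derivative_Pair[OF scal[OF d\<rho>, of "e \<theta>"] scal[OF this, of w]]]]
    have dF: "((\<lambda>t. lag L (\<sigma> t, u, \<rho> t *\<^sub>R e \<theta>, (\<rho> t)\<^sup>2 *\<^sub>R w)) has_real_derivative
        ?F' (s - s0, 0, (r - r0) *\<^sub>R e \<theta>, (2 * \<rho> t * (r - r0)) *\<^sub>R w)) (at t within {0..1})"
      unfolding has_real_derivative_iff_has_vector_derivative
      by (rule smooth_on_chain_vector[OF smooth_lag[OF L(1)] dphase _ t]) (use \<sigma> \<rho> e_nz in fastforce)
    note dpolar = has_vector_derivative_Pair[OF d\<sigma>[unfolded has_real_derivative_iff_has_vector_derivative]
      has_vector_derivative_Pair[OF has_vector_derivative_const[of u]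
        has_vector_derivative_Pair[OF d\<rho>[unfolded has_real_derivative_iff_has_vector_derivative]
          has_vector_derivative_const[of \<theta>]]]]
    have dC: "((\<lambda>t. polar_charge L e (\<sigma> t, u, \<rho> t, \<theta>)) has_real_derivative
        deriv_on polar_dom (polar_charge L e) (\<sigma> t, u, \<rho> t, \<theta>) (s - s0, 0, r - r0, 0)) (at t within {0..1})"
      unfolding has_real_derivative_iff_has_vector_derivative
      by (rule smooth_on_chain_vector[OF smooth_polar_charge dpolar _ t]) (use \<sigma> \<rho> in fastforce)
    define F where "F = lag L ?x"
    define C where "C = charge L ?xo"
    define c1 where "c1 = ?C' (1, 0, 0, 0)"
    define c2 where "c2 = ?C' (0, ?p, ?q, 0)"
    define b1 where "b1 = ?B' (1, 0, 0, 0)"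
    define b2 where "b2 = ?B' (0, ?p, ?q, 0)"
    \<comment> \<open>Closedness makes the s-derivative of B cancel against the p-derivative of C in
      the difference L - C.\<close>
    have c3: "?C' (0, 0, ?p, 0) = b1" using charge_momentum_closed[OF L x0] by (simp add: b1_def)
    have \<rho>t: "\<rho> t > 0" using \<rho>[OF t] .
    \<comment> \<open>With zeta fixed, p grows like rho and q like rho^2. The velocity therefore
      splits into an s-part and a multiple of the scaling direction (p, 2q), the two directions in
      which the derivative of L is known.\<close>
    have "(s - s0, 0, (r - r0) *\<^sub>R e \<theta>, (2 * \<rho> t * (r - r0)) *\<^sub>R w)
        = (s - s0) *\<^sub>R (1, 0 :: real^'n, 0, 0) + ((r - r0) / \<rho> t) *\<^sub>R (0, 0, ?p, 2 *\<^sub>R ?q)"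
      using \<rho>t by (simp add: power2_eq_square mult_ac)
    then have "?F' (s - s0, 0, (r - r0) *\<^sub>R e \<theta>, (2 * \<rho> t * (r - r0)) *\<^sub>R w)
        = (s - s0) * ?F' (1, 0, 0, 0) + ((r - r0) / \<rho> t) * ?F' (0, 0, ?p, 2 *\<^sub>R ?q)"
      by (simp only: linear_add[OF linF] linear_cmul[OF linF] real_scaleR_def)
    moreover have "?F' (1, 0, 0, 0) = c1 + c2"
      using lag_s_deriv[OF L x] linear_add[OF linC, of "(1, 0, 0, 0)" "(0, ?p, ?q, 0)"]
      by (simp add: c1_def c2_def)
    moreover have "?F' (0, 0, ?p, 2 *\<^sub>R ?q) = F + (b1 + b2) - C"
      using lag_scaling_deriv[OF L x] linear_add[OF linB, of "(1, 0, 0, 0)" "(0, ?p, ?q, 0)"]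
      by (simp add: b1_def b2_def F_def C_def)
    ultimately have F': "?F' (s - s0, 0, (r - r0) *\<^sub>R e \<theta>, (2 * \<rho> t * (r - r0)) *\<^sub>R w)
        = (s - s0) * (c1 + c2) + ((r - r0) / \<rho> t) * (F + (b1 + b2) - C)" by simp
    have "(s - s0, 0, (r - r0) *\<^sub>R e \<theta>, 0)
        = (s - s0) *\<^sub>R (1, 0 :: real^'n, 0, 0 :: real^'n) + ((r - r0) / \<rho> t) *\<^sub>R (0, 0, ?p, 0)"
      using \<rho>t by simp
    then have "?C' (s - s0, 0, (r - r0) *\<^sub>R e \<theta>, 0) = (s - s0) * c1 + ((r - r0) / \<rho> t) * b1"
      by (simp only: linear_add[OF linC] linear_cmul[OF linC] real_scaleR_def c1_def c3)
    then have C': "deriv_on polar_dom (polar_charge L e) (\<sigma> t, u, \<rho> t, \<theta>) (s - s0, 0, r - r0, 0)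
        = (s - s0) * c1 + ((r - r0) / \<rho> t) * b1"
      by (simp add: polar_charge_deriv[OF y] e'0)
    \<comment> \<open>Moving u by e and theta by zeta is, up to the factor 1 / rho, moving u by p
      and p by q: the part of the total derivative that acts on u and theta.\<close>
    have dir: "(0, e \<theta>, \<rho> t *\<^sub>R w, 0) = (1 / \<rho> t) *\<^sub>R (0 :: real, ?p, ?q, 0 :: real^'n)"
      using \<rho>t by (simp add: power2_eq_square)
    have "?C' (0, e \<theta>, \<rho> t *\<^sub>R w, 0) = c2 / \<rho> t" "?B' (0, e \<theta>, \<rho> t *\<^sub>R w, 0) = b2 / \<rho> t"
      unfolding dir linear_cmul[OF linC] linear_cmul[OF linB] by (simp_all add: c2_def b2_def)
    then have I: "I t = (s - s0) * (c2 / \<rho> t) + (r - r0) * (b2 / \<rho> t * inverse (\<rho> t))"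
      unfolding I_def polar_charge_deriv[OF y] polar_momentum_deriv[OF y] by (simp add: w_def)
    have N: "N t = F - C" by (simp add: N_def F_def C_def polar_charge_def)
    have "(N has_real_derivative (s - s0) * (c1 + c2) + ((r - r0) / \<rho> t) * (F + (b1 + b2) - C)
        - ((s - s0) * c1 + ((r - r0) / \<rho> t) * b1)) (at t within {0..1})"
      using DERIV_diff[OF dF dC] unfolding F' C' by (simp add: N_def[abs_def])
    \<comment> \<open>The derivative of N contains (r - r0) / rho times N itself; dividing by rho
      removes exactly this term, and \<open>c2\<close> and \<open>b2\<close> remain.\<close>
    from DERIV_divide[OF this d\<rho>]
    show ?thesis
      by (rule DERIV_cong) (use \<rho>t in \<open>simp_all add: I N field_simps\<close>)
  qed
  have "(I has_integral N 1 / \<rho> 1 - N 0 / \<rho> 0) {0..1}"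
    by (rule fundamental_theorem_of_calculus)
      (use dN in \<open>auto simp: has_real_derivative_iff_has_vector_derivative\<close>)
  moreover have "deriv_on polar_dom (primitive s0 r0 (polar_charge L e) (polar_momentum L e)) (s, u, r, \<theta>) (0, e \<theta>, 0, \<zeta>)
      = integral {0..1} I"
    using primitive_has_derivative[OF smooth_polar_charge smooth_polar_momentum s0 r0 z, of 0 "e \<theta>" 0 \<zeta>]
    by (simp add: I_def[abs_def] \<sigma>_def \<rho>_def)
  ultimately show ?thesis
    by (simp add: integral_unique N_def \<sigma>_def \<rho>_def w_def polar_rest_def divide_inverse)
qed

text \<open>Here q = r^2 e_theta[eta / r] + xi p. \<open>lag_affine\<close> splits off the xi-part,
  which is r xi Xi_r; \<open>polar_segment\<close> expresses the rest by C = Xi_s, by r times the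
  derivative of Xi along (e, zeta) in (u, theta), and by f. Since p = r e and eta = r zeta, these
  assemble to the total derivative.\<close>

lemma polar_representation:
  assumes s0: "s0 \<in> {0..1}" and r0: "r0 > 0" and z: "(s, u, r, \<theta>) \<in> polar_dom"
  shows "L s u (r *\<^sub>R e \<theta>) ((r * \<xi>) *\<^sub>R e \<theta> + r *\<^sub>R deriv_on UNIV e \<theta> \<eta>)
    = deriv_on polar_dom (primitive s0 r0 (polar_charge L e) (polar_momentum L e)) (s, u, r, \<theta>)
        (1, r *\<^sub>R e \<theta>, r * \<xi>, \<eta>)
      + r * polar_rest s0 r0 u \<theta> (\<eta> /\<^sub>R r)"
proof -
  let ?\<Xi> = "primitive s0 r0 (polar_charge L e) (polar_momentum L e)"
  let ?\<Xi>' = "deriv_on polar_dom ?\<Xi> (s, u, r, \<theta>)"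
  let ?p = "r *\<^sub>R e \<theta>" and ?\<zeta> = "\<eta> /\<^sub>R r"
  let ?q = "r\<^sup>2 *\<^sub>R deriv_on UNIV e \<theta> ?\<zeta>"
  have r: "r > 0" using z by simp
  have x: "(s, u, ?p, ?q) \<in> phase_dom" using z e_nz by auto
  note smooth = smooth_polar_charge smooth_polar_momentum
  note lin = smooth_on_deriv_linear[OF smooth_primitive[OF smooth s0 r0] z]
  have \<Xi>s: "?\<Xi>' (1, 0, 0, 0) = polar_charge L e (s, u, r, \<theta>)"
    and \<Xi>r: "?\<Xi>' (0, 0, 1, 0) = polar_momentum L e (s, u, r, \<theta>)"
    by (rule primitive_closed[OF smooth s0 r0 _ z], rule polar_closed, assumption)+
  have "deriv_on UNIV e \<theta> ?\<zeta> = deriv_on UNIV e \<theta> \<eta> /\<^sub>R r"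
    by (rule linear_cmul[OF smooth_on_deriv_linear[OF e]]) simp
  then have q: "(r * \<xi>) *\<^sub>R e \<theta> + r *\<^sub>R deriv_on UNIV e \<theta> \<eta> = ?q + \<xi> *\<^sub>R ?p"
    using r by (simp add: power2_eq_square mult.commute)
  have "L s u ?p ((r * \<xi>) *\<^sub>R e \<theta> + r *\<^sub>R deriv_on UNIV e \<theta> \<eta>) = lag L (s, u, ?p, ?q + \<xi> *\<^sub>R ?p)"
    unfolding q by (simp add: lag_def)
  also have "\<dots> = lag L (s, u, ?p, ?q) + \<xi> * momentum L (s, u, ?p, 0)"
    by (rule lag_affine[OF L x])
  also have "momentum L (s, u, ?p, 0) = r * polar_momentum L e (s, u, r, \<theta>)"
    using r by (simp add: polar_momentum_def)
  also have "lag L (s, u, ?p, ?q) = polar_charge L e (s, u, r, \<theta>) + r * (?\<Xi>' (0, e \<theta>, 0, ?\<zeta>) + polar_rest s0 r0 u \<theta> ?\<zeta>)"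
    unfolding polar_segment[OF s0 r0 z, symmetric] using r by (simp add: field_simps)
  finally have *: "L s u ?p ((r * \<xi>) *\<^sub>R e \<theta> + r *\<^sub>R deriv_on UNIV e \<theta> \<eta>)
      = ?\<Xi>' (1, 0, 0, 0) + r * ?\<Xi>' (0, e \<theta>, 0, ?\<zeta>) + (r * \<xi>) * ?\<Xi>' (0, 0, 1, 0) + r * polar_rest s0 r0 u \<theta> ?\<zeta>"
    unfolding \<Xi>s \<Xi>r by (simp add: algebra_simps)
  have "(1, ?p, r * \<xi>, \<eta>) = (1, 0, 0, 0) + r *\<^sub>R (0 :: real, e \<theta>, 0 :: real, ?\<zeta>) + (r * \<xi>) *\<^sub>R (0, 0, 1, 0)"
    using r by simp
  then have "?\<Xi>' (1, ?p, r * \<xi>, \<eta>)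
      = ?\<Xi>' (1, 0, 0, 0) + r * ?\<Xi>' (0, e \<theta>, 0, ?\<zeta>) + (r * \<xi>) * ?\<Xi>' (0, 0, 1, 0)"
    by (simp only: linear_add[OF lin] linear_cmul[OF lin] real_scaleR_def)
  with * show ?thesis by simp
qed

end

section \<open>The spherical chart\<close>

lemma idx_strict_mono: "i < j \<Longrightarrow> idx i < idx j"
  unfolding idx_def by (rule psubset_card_mono) auto

lemma bij_betw_idx: "bij_betw idx (UNIV :: 'a::{finite,linorder} set) {..<CARD('a)}"
proof -
  have inj: "inj (idx :: 'a \<Rightarrow> nat)"
    using idx_strict_mono by (metis injI less_irrefl linorder_neqE)
  moreover have "idx i < CARD('a)" for i :: 'a
    unfolding idx_def by (rule psubset_card_mono) auto
  then have "range (idx :: 'a \<Rightarrow> nat) = {..<CARD('a)}"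
    using inj by (intro card_subset_eq) (auto simp: card_image)
  ultimately show ?thesis by (simp add: bij_betw_def)
qed

lemma smooth_phat: "smooth_on UNIV phat"
  unfolding phat_def[abs_def]
  by (intro smooth_on_vec smooth_on_mult smooth_on_prod smooth_on_sin smooth_on_cos smooth_on_vec_nth
      smooth_on_ident) auto

text \<open>If some sine vanishes, take the first such angle: the component at its position is a
  product of nonzero sines with a cosine of absolute value 1. Otherwise the last component, a
  product of sines alone, is nonzero.\<close>

lemma phat_nonzero:
  fixes \<theta> :: "real^'m::{finite,linorder}"
  assumes "CARD('n::{finite,linorder}) = CARD('m) + 1"
  shows "(phat \<theta> :: real^'n::_) \<noteq> 0"
proof -
  have surj: "\<exists>k :: 'n. idx k = i" if "i < CARD('n)" for i
    using bij_betw_imp_surj_on[OF bij_betw_idx[where 'a = 'n]] that by (metis imageE lessThan_iff)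
  have inj: "inj (idx :: 'm \<Rightarrow> nat)" using bij_betw_idx bij_betw_def by blast
  have bound: "idx j < CARD('m)" for j :: 'm
    using bij_betw_imp_surj_on[OF bij_betw_idx[where 'a = 'm]] by auto
  have "\<exists>k. phat \<theta> $ (k :: 'n) \<noteq> 0"
  proof (cases "\<exists>j. sin (\<theta> $ j) = 0")
    case True
    then obtain j where j: "sin (\<theta> $ j) = 0" and least: "\<And>i. sin (\<theta> $ i) = 0 \<Longrightarrow> idx j \<le> idx i"
      using ex_has_least_nat[of "\<lambda>j. sin (\<theta> $ j) = 0" _ idx] by blast
    obtain k :: 'n where k: "idx k = idx j" using surj[of "idx j"] bound[of j] assms by auto
    have "{i. idx i = idx k} = {j}" using inj by (auto simp: k inj_eq)
    moreover have "cos (\<theta> $ j) \<noteq> 0" using j sin_zero_abs_cos_one by fastforce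
    moreover have "(\<Prod>i | idx i < idx k. sin (\<theta> $ i)) \<noteq> 0" using least by (force simp: k)
    ultimately show ?thesis by (intro exI[of _ k]) (simp add: phat_def)
  next
    case False
    obtain k :: 'n where k: "idx k = CARD('m)" using surj[of "CARD('m)"] assms by auto
    then have "{i :: 'm. idx i = idx k} = {}" using bound by (auto simp: less_le)
    with False show ?thesis by (intro exI[of _ k]) (simp add: phat_def)
  qed
  then show ?thesis by (metis zero_index)
qed

lemma phat_jac_mult:
  fixes \<theta> :: "real^'m::{finite,linorder}"
  shows "(phat_jac \<theta> :: real^'m::_^'n::{finite,linorder}) *v \<eta> = deriv_on UNIV phat \<theta> \<eta>"
proof -
  have d: "(phat has_derivative deriv_on UNIV phat \<theta>) (at \<theta>)"
    using smooth_on_has_derivative[OF smooth_phat] by simp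
  then have "(phat :: _ \<Rightarrow> real^'n::_) differentiable at \<theta>" by (auto simp: differentiable_def)
  then have "((phat :: _ \<Rightarrow> real^'n::_) has_derivative (\<lambda>h. phat_jac \<theta> *v h)) (at \<theta>)"
    unfolding phat_jac_def by (simp add: jacobian_works)
  from has_derivative_unique[OF this d] show ?thesis by metis
qed

theorem theorem4p1:
  fixes L :: "real \<Rightarrow> real^'n::{finite,linorder} \<Rightarrow> real^'n::_ \<Rightarrow> real^'n::_ \<Rightarrow> real"
    and s0 r0 \<xi>0 :: real
    and u0 :: "real^'n::_"
    and \<theta>0 \<eta>0 :: "real^'m::{finite,linorder}"
  assumes "CARD('n) > 1"
    and "CARD('n) = CARD('m) + 1"
    and "smooth_lagrangian L"
    and "T_lagrangian L"
    and "s0 \<in> {0..1}"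
    and "r0 > 0"
    and "rank (phat_jac \<theta>0 :: real^'m::_^'n::_) = CARD('n) - 1"
  shows "\<exists>(\<Xi> :: real \<Rightarrow> real^'n::_ \<Rightarrow> real \<Rightarrow> real^'m::_ \<Rightarrow> real)
          (f :: real^'n::_ \<Rightarrow> real^'m::_ \<Rightarrow> real^'m::_ \<Rightarrow> real) V W N.
      open V \<and> (s0, u0, r0, \<theta>0) \<in> V \<and>
      smooth_on (V \<inter> {0..1} \<times> UNIV) (\<lambda>(s, u, r, \<theta>). \<Xi> s u r \<theta>) \<and>
      open W \<and> (u0, \<theta>0, \<eta>0 /\<^sub>R r0) \<in> W \<and>
      smooth_on W (\<lambda>(u, \<theta>, \<zeta>). f u \<theta> \<zeta>) \<and>
      open N \<and> (s0, u0, r0, \<theta>0, \<xi>0, \<eta>0) \<in> N \<and>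
      (\<forall>s u r \<theta> \<xi> \<eta>. (s, u, r, \<theta>, \<xi>, \<eta>) \<in> N \<and> s \<in> {0..1} \<longrightarrow>
        (s, u, r, \<theta>) \<in> V \<and> (u, \<theta>, \<eta> /\<^sub>R r) \<in> W \<and>
        (let p = r *\<^sub>R phat \<theta>;
             q = (r * \<xi>) *\<^sub>R phat \<theta> + r *\<^sub>R (phat_jac \<theta> *v \<eta>)
         in L s u p q =
              vector_derivative (\<lambda>t. \<Xi> t u r \<theta>) (at s within {0..1})
            + p \<bullet> gradient (\<lambda>x. \<Xi> s x r \<theta>) u
            + r * \<xi> * deriv (\<lambda>\<rho>. \<Xi> s u \<rho> \<theta>) r
            + \<eta> \<bullet> gradient (\<lambda>\<phi>. \<Xi> s u r \<phi>) \<theta>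
            + r * f u \<theta> (\<eta> /\<^sub>R r)))"
proof -
  let ?e = "phat :: real^'m::_ \<Rightarrow> real^'n::_"
  have e_nz: "?e \<theta> \<noteq> 0" for \<theta> by (rule phat_nonzero[OF assms(2)])
  note ctx = assms(3,4) smooth_phat e_nz
  define X where "X = primitive s0 r0 (polar_charge L ?e) (polar_momentum L ?e)"
  define \<Xi> where "\<Xi> s u r \<theta> = X (s, u, r, \<theta>)" for s u r \<theta>
  \<comment> \<open>The construction works for all r > 0 and all theta, so the neighbourhoods can be
    taken this large, and the domain of f is everything.\<close>
  define V :: "(real \<times> (real^'n::_) \<times> real \<times> (real^'m::_)) set" where "V = UNIV \<times> UNIV \<times> {0<..} \<times> UNIV"
  define N :: "(real \<times> (real^'n::_) \<times> real \<times> (real^'m::_) \<times> real \<times> (real^'m::_)) set"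
    where "N = UNIV \<times> UNIV \<times> {0<..} \<times> UNIV"
  have smX: "smooth_on polar_dom X"
    unfolding X_def
    by (rule smooth_primitive[OF smooth_polar_charge[OF ctx] smooth_polar_momentum[OF ctx] assms(5,6)])
  \<comment> \<open>It remains to identify the four one-variable derivatives of the statement with
    components of the joint derivative of \<open>X\<close>; the one in s is taken within [0,1],
    hence one-sided at its ends.\<close>
  have rep: "L s u (r *\<^sub>R ?e \<theta>) ((r * \<xi>) *\<^sub>R ?e \<theta> + r *\<^sub>R (phat_jac \<theta> *v \<eta>))
      = vector_derivative (\<lambda>t. \<Xi> t u r \<theta>) (at s within {0..1})
        + r *\<^sub>R ?e \<theta> \<bullet> gradient (\<lambda>x. \<Xi> s x r \<theta>) u
        + r * \<xi> * deriv (\<lambda>\<rho>. \<Xi> s u \<rho> \<theta>) r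
        + \<eta> \<bullet> gradient (\<lambda>\<phi>. \<Xi> s u r \<phi>) \<theta>
        + r * polar_rest L ?e s0 r0 u \<theta> (\<eta> /\<^sub>R r)" if s: "s \<in> {0..1}" and r: "r > 0" for s u r \<theta> \<xi> \<eta>
  proof -
    let ?X' = "deriv_on polar_dom X (s, u, r, \<theta>)"
    have z: "(s, u, r, \<theta>) \<in> polar_dom" using s r by simp
    note X' = smooth_on_has_derivative[OF smX z]
    note lin = has_derivative_linear[OF X']
    have "((\<lambda>t. X (t, u, r, \<theta>)) has_derivative (\<lambda>h. ?X' (h, 0, 0, 0))) (at s within {0..1})"
      by (rule has_derivative_chain[where f = "\<lambda>t. (t, u, r, \<theta>)", OF X'])
        (use r in \<open>auto intro!: derivative_eq_intros simp: zero_prod_def\<close>)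
    moreover have "(\<lambda>h. ?X' (h, 0, 0, 0)) = (\<lambda>h. h *\<^sub>R ?X' (1, 0, 0, 0))"
    proof
      show "?X' (h, 0, 0, 0) = h *\<^sub>R ?X' (1, 0, 0, 0)" for h
        using linear_cmul[OF lin, of h "(1, 0, 0, 0)"] by simp
    qed
    ultimately have "((\<lambda>t. \<Xi> t u r \<theta>) has_vector_derivative ?X' (1, 0, 0, 0)) (at s within {0..1})"
      unfolding has_vector_derivative_def \<Xi>_def by (simp only:)
    then have ds: "vector_derivative (\<lambda>t. \<Xi> t u r \<theta>) (at s within {0..1}) = ?X' (1, 0, 0, 0)"
      using vector_derivative_within_cbox[of 0 1 s] s by simp
    have "((\<lambda>x. X (s, x, r, \<theta>)) has_derivative (\<lambda>h. ?X' (0, h, 0, 0))) (at u within UNIV)"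
      by (rule has_derivative_chain[where f = "\<lambda>x. (s, x, r, \<theta>)", OF X'])
        (use s r in \<open>auto intro!: derivative_eq_intros simp: zero_prod_def\<close>)
    then have du: "h \<bullet> gradient (\<lambda>x. \<Xi> s x r \<theta>) u = ?X' (0, h, 0, 0)" for h
      unfolding \<Xi>_def inner_commute[of h] by (intro gradient_inner) simp
    have "((\<lambda>\<rho>. X (s, u, \<rho>, \<theta>)) has_derivative (\<lambda>h. ?X' (0, 0, h, 0))) (at r within {0<..})"
      by (rule has_derivative_chain[where f = "\<lambda>\<rho>. (s, u, \<rho>, \<theta>)", OF X'])
        (use s r in \<open>auto intro!: derivative_eq_intros simp: zero_prod_def\<close>)
    then have "((\<lambda>\<rho>. X (s, u, \<rho>, \<theta>)) has_derivative (\<lambda>h. ?X' (0, 0, h, 0))) (at r)"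
      using r at_within_open[of r "{0<..}"] by simp
    moreover have "(\<lambda>h. ?X' (0, 0, h, 0)) = (*) (?X' (0, 0, 1, 0))"
    proof
      show "?X' (0, 0, h, 0) = ?X' (0, 0, 1, 0) * h" for h
        using linear_cmul[OF lin, of h "(0, 0, 1, 0)"] by (simp add: mult.commute)
    qed
    ultimately have "((\<lambda>\<rho>. \<Xi> s u \<rho> \<theta>) has_real_derivative ?X' (0, 0, 1, 0)) (at r)"
      unfolding has_field_derivative_def \<Xi>_def by (simp only:)
    then have dr: "deriv (\<lambda>\<rho>. \<Xi> s u \<rho> \<theta>) r = ?X' (0, 0, 1, 0)" by (rule DERIV_imp_deriv)
    have "((\<lambda>\<phi>. X (s, u, r, \<phi>)) has_derivative (\<lambda>h. ?X' (0, 0, 0, h))) (at \<theta> within UNIV)"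
      by (rule has_derivative_chain[where f = "\<lambda>\<phi>. (s, u, r, \<phi>)", OF X'])
        (use s r in \<open>auto intro!: derivative_eq_intros simp: zero_prod_def\<close>)
    then have d\<theta>: "\<eta> \<bullet> gradient (\<lambda>\<phi>. \<Xi> s u r \<phi>) \<theta> = ?X' (0, 0, 0, \<eta>)"
      unfolding \<Xi>_def inner_commute[of \<eta>] by (intro gradient_inner) simp
    have "(1, r *\<^sub>R ?e \<theta>, r * \<xi>, \<eta>)
        = (1, 0, 0, 0) + (0, r *\<^sub>R ?e \<theta>, 0, 0) + (r * \<xi>) *\<^sub>R (0, 0, 1, 0) + (0 :: real, 0, 0 :: real, \<eta>)"
      by simp
    then have "?X' (1, r *\<^sub>R ?e \<theta>, r * \<xi>, \<eta>) = ?X' (1, 0, 0, 0) + ?X' (0, r *\<^sub>R ?e \<theta>, 0, 0)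
        + r * \<xi> * ?X' (0, 0, 1, 0) + ?X' (0, 0, 0, \<eta>)"
      by (simp only: linear_add[OF lin] linear_cmul[OF lin] real_scaleR_def)
    then show ?thesis
      unfolding phat_jac_mult polar_representation[OF ctx assms(5,6) z] ds du dr d\<theta> X_def by simp
  qed
  have "open V" "open N" unfolding V_def N_def by (intro open_Times open_UNIV open_greaterThan)+
  \<comment> \<open>Intersecting \<open>V\<close> with the strip over [0,1] gives back
    \<open>polar_dom\<close>.\<close>
  moreover have "smooth_on (V \<inter> {0..1} \<times> UNIV) (\<lambda>(s, u, r, \<theta>). \<Xi> s u r \<theta>)"
    using smooth_on_subset[OF smX, of "V \<inter> {0..1} \<times> UNIV"] by (force simp: V_def \<Xi>_def case_prod_unfold)
  moreover have "smooth_on UNIV (\<lambda>(u, \<theta>, \<zeta>). polar_rest L ?e s0 r0 u \<theta> \<zeta>)"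
    by (rule smooth_polar_rest[OF ctx assms(5,6)])
  moreover have "(s0, u0, r0, \<theta>0) \<in> V" "(s0, u0, r0, \<theta>0, \<xi>0, \<eta>0) \<in> N"
    using assms(6) by (auto simp: V_def N_def)
  ultimately show ?thesis
    by (intro exI[of _ \<Xi>] exI[of _ "polar_rest L ?e s0 r0"] exI[of _ V] exI[of _ UNIV] exI[of _ N])
      (auto simp: Let_def rep V_def N_def)
qed

end
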